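(* Let $G$ be an affine algebraic group over $\mathbb{C}$, let $J$ be a Hopf $2$-cocycle for $\mathcal{O}(G)$, and let $H\subseteq G$ be the support of $J$. Then the center $Z$ of the algebra $\mathcal{O}(G)_J$ is isomorphic to $\mathcal{O}(G/H)$. In particular, if $J$ is minimal then the center of $\mathcal{O}(G)_J$ is trivial (i.e. equal to $\mathbb{C}$), and if $G/H$ is affine then the converse holds too.
   Context: Everything is over $\mathbb{C}$; $\mathcal{O}(G)$ is the Hopf algebra of regular functions on $G$, with Sweedler notation $\Delta(a)=\sum a_1\otimes a_2$. $\mathcal{O}(G/H)$ is the algebra of regular functions on the variety $G/H$, i.e. of functions $\varphi\in\mathcal{O}(G)$ with $\varphi(gh)=\varphi(g)$ for all $g\in G$, $h\in H$. A Hopf $2$-cocycle for a Hopf algebra $A$ is a linear map $J:A\otimes A\to\mathbb{C}$, invertible under the convolution product $*$ of $\mathrm{Hom}_{\mathbb{C}}(A\otimes A,\mathbb{C})$, such that $\sum J(a_1b_1,c)J(a_2,b_2)=\sum J(a,b_1c_1)J(b_2,c_2)$ and $J(a,1)=\varepsilon(a)=J(1,a)$ for all $a,b,c\in A$. Two Hopf $2$-cocycles $J,J'$ for $A$ are gauge equivalent if $J'=(\chi\circ m)*J*(\chi^{-1}\otimes\chi^{-1})$ for some convolution-invertible linear map $\chi:A\to\mathbb{C}$ with $\chi(1)=1$, where $m$ is the multiplication of $A$. $\mathcal{O}(G)_J$ is the algebra with underlying space $\mathcal{O}(G)$ and multiplication $m_J(a\otimes b)=\sum a_1b_1J(a_2,b_2)$.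 Put $J_{21}(a,b):=J(b,a)$ and $R^J:=J_{21}^{-1}*J$. $J$ is minimal if the bilinear form $R^J$ is nondegenerate, i.e. $\{a\mid R^J(b,a)=0 \text{ for all } b\}=0$. The support of $J$ is the closed subgroup $H$ of $G$ (well defined up to conjugation) such that $J$ is gauge equivalent to a minimal Hopf $2$-cocycle for $\mathcal{O}(H)$, viewed as a Hopf $2$-cocycle for $\mathcal{O}(G)$ via the restriction map $\mathcal{O}(G)\twoheadrightarrow\mathcal{O}(H)$. *)

theory Defs
  imports "HOL-Analysis.Abstract_Topology" "HOL-Algebra.QuotRing" "HOL-Algebra.Module"
begin

section \<open>Affine varieties over the complex numbers\<close>

text \<open>
  Affine \<open>n\<close>-space is the set of sequences \<open>x :: nat \<Rightarrow> complex\<close> vanishing from index \<open>n\<close> on, so that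
  all dimensions live in one type. A variety is a Zariski closed subset of some affine
  \<open>n\<close>-space, i.e. it is given by its complex points and is reduced but possibly reducible.
\<close>

type_synonym point = "nat \<Rightarrow> complex"

definition affine_space :: "nat \<Rightarrow> point set" where
  "affine_space n = {x. \<forall>i\<ge>n. x i = 0}"

inductive_set generated_functions :: "('p \<Rightarrow> complex) set \<Rightarrow> ('p \<Rightarrow> complex) set"
  for S :: "('p \<Rightarrow> complex) set" where
  const: "(\<lambda>_. c) \<in> generated_functions S"
| gen: "f \<in> S \<Longrightarrow> f \<in> generated_functions S"
| add: "f \<in> generated_functions S \<Longrightarrow> g \<in> generated_functions S \<Longrightarrow> (\<lambda>x. f x + g x) \<in> generated_functions S"
| mult: "f \<in> generated_functions S \<Longrightarrow> g \<in> generated_functions S \<Longrightarrow> (\<lambda>x. f x * g x) \<in> generated_functions S"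

definition poly_functions :: "(point \<Rightarrow> complex) set" where
  "poly_functions = generated_functions (range (\<lambda>i x. x i))"

text \<open>Polynomial functions on the product of two affine spaces.\<close>

definition poly_functions2 :: "(point \<times> point \<Rightarrow> complex) set" where
  "poly_functions2 = generated_functions (range (\<lambda>i (x, y). x i) \<union> range (\<lambda>i (x, y). y i))"

definition zariski :: "nat \<Rightarrow> point topology" where
  "zariski n = topology (\<lambda>U. \<exists>F\<subseteq>poly_functions. U = {x \<in> affine_space n. \<exists>f\<in>F. f x \<noteq> 0})"

lemma istopology_zariski:
  "istopology (\<lambda>U. \<exists>F\<subseteq>poly_functions. U = {x \<in> affine_space n. \<exists>f\<in>F. f x \<noteq> 0})"
  unfolding istopology_def
proof (intro conjI allI impI)
  fix S T :: "point set"
  assume "\<exists>F\<subseteq>poly_functions. S = {x \<in> affine_space n. \<exists>f\<in>F. f x \<noteq> 0}"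
    and "\<exists>F\<subseteq>poly_functions. T = {x \<in> affine_space n. \<exists>f\<in>F. f x \<noteq> 0}"
  then obtain F G where F: "F \<subseteq> poly_functions" "S = {x \<in> affine_space n. \<exists>f\<in>F. f x \<noteq> 0}"
    and G: "G \<subseteq> poly_functions" "T = {x \<in> affine_space n. \<exists>f\<in>G. f x \<noteq> 0}"
    by blast
  let ?H = "(\<lambda>(f, g) x. f x * g x) ` (F \<times> G)"
  have "?H \<subseteq> poly_functions"
    using F(1) G(1) by (auto simp: poly_functions_def intro!: generated_functions.mult)
  moreover have "S \<inter> T = {x \<in> affine_space n. \<exists>f\<in>?H. f x \<noteq> 0}"
    using F(2) G(2) by auto
  ultimately show "\<exists>F\<subseteq>poly_functions. S \<inter> T = {x \<in> affine_space n. \<exists>f\<in>F. f x \<noteq> 0}"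
    by blast
next
  fix K :: "point set set"
  assume "\<forall>U\<in>K. \<exists>F\<subseteq>poly_functions. U = {x \<in> affine_space n. \<exists>f\<in>F. f x \<noteq> 0}"
  then have "\<exists>F. \<forall>U\<in>K. F U \<subseteq> poly_functions \<and> U = {x \<in> affine_space n. \<exists>f\<in>F U. f x \<noteq> 0}"
    by (rule bchoice)
  then obtain F where F: "\<And>U. U \<in> K \<Longrightarrow> F U \<subseteq> poly_functions"
    "\<And>U x. U \<in> K \<Longrightarrow> x \<in> U \<longleftrightarrow> x \<in> affine_space n \<and> (\<exists>f\<in>F U. f x \<noteq> 0)"
    by (smt (verit) mem_Collect_eq)
  have "\<Union>K = {x \<in> affine_space n. \<exists>f\<in>(\<Union>U\<in>K. F U). f x \<noteq> 0}"
    using F(2) by (intro Set.set_eqI) auto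
  moreover have "(\<Union>U\<in>K. F U) \<subseteq> poly_functions"
    using F(1) by blast
  ultimately show "\<exists>F\<subseteq>poly_functions. \<Union>K = {x \<in> affine_space n. \<exists>f\<in>F. f x \<noteq> 0}"
    by blast
qed

lemma openin_zariski:
  "openin (zariski n) U \<longleftrightarrow> (\<exists>F\<subseteq>poly_functions. U = {x \<in> affine_space n. \<exists>f\<in>F. f x \<noteq> 0})"
  unfolding zariski_def by (simp add: topology_inverse'[OF istopology_zariski])

lemma topspace_zariski [simp]: "topspace (zariski n) = affine_space n"
proof -
  have "openin (zariski n) (affine_space n)"
    unfolding openin_zariski
    by (rule exI[of _ "{\<lambda>_. 1}"])
       (auto simp: poly_functions_def intro: generated_functions.const)
  then show ?thesis
    using openin_subset by (auto simp: topspace_def openin_zariski)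
qed

lemma closedin_zariski:
  "closedin (zariski n) X \<longleftrightarrow> (\<exists>F\<subseteq>poly_functions. X = {x \<in> affine_space n. \<forall>f\<in>F. f x = 0})"
  (is "?L \<longleftrightarrow> ?R")
proof
  assume ?L
  then obtain F where "X \<subseteq> affine_space n" "F \<subseteq> poly_functions"
    "affine_space n - X = {x \<in> affine_space n. \<exists>f\<in>F. f x \<noteq> 0}"
    by (auto simp: closedin_def openin_zariski)
  then show ?R
    by (intro exI[of _ F]) blast
next
  assume ?R
  then obtain F where "F \<subseteq> poly_functions" "X = {x \<in> affine_space n. \<forall>f\<in>F. f x = 0}"
    by blast
  then show ?L
    unfolding closedin_def openin_zariski by auto
qed

definition regular_functions :: "point set \<Rightarrow> (point \<Rightarrow> complex) set" where
  "regular_functions X = (\<lambda>f. restrict f X) ` poly_functions"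


section \<open>Spaces with functions and the quotient variety\<close>

text \<open>
  A space with functions is a topological space together with, for each open \<open>U\<close>, the set of its
  regular functions on \<open>U\<close>. Values of such functions outside \<open>U\<close> are irrelevant.
\<close>

record 'p function_space =
  top_of :: "'p topology"
  functions_on :: "'p set \<Rightarrow> ('p \<Rightarrow> complex) set"

definition affine_function_space :: "nat \<Rightarrow> point set \<Rightarrow> point function_space" where
  "affine_function_space n X =
    \<lparr>top_of = subtopology (zariski n) X,
     functions_on = (\<lambda>U. {f. \<forall>x\<in>U. \<exists>V. openin (subtopology (zariski n) X) V \<and> x \<in> V \<and> V \<subseteq> U \<and>
        (\<exists>p\<in>poly_functions. \<exists>q\<in>poly_functions. \<forall>y\<in>V. q y \<noteq> 0 \<and> f y = p y / q y)})\<rparr>"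

definition quotient_top :: "'p topology \<Rightarrow> ('p \<Rightarrow> 'q) \<Rightarrow> 'q topology" where
  "quotient_top T \<pi> =
    topology (\<lambda>U. U \<subseteq> \<pi> ` topspace T \<and> openin T {x \<in> topspace T. \<pi> x \<in> U})"

lemma istopology_quotient:
  "istopology (\<lambda>U. U \<subseteq> \<pi> ` topspace T \<and> openin T {x \<in> topspace T. \<pi> x \<in> U})"
  unfolding istopology_def
proof (intro conjI allI impI)
  fix S U
  assume *: "S \<subseteq> \<pi> ` topspace T \<and> openin T {x \<in> topspace T. \<pi> x \<in> S}"
    "U \<subseteq> \<pi> ` topspace T \<and> openin T {x \<in> topspace T. \<pi> x \<in> U}"
  then show "S \<inter> U \<subseteq> \<pi> ` topspace T"
    by blast
  have "{x \<in> topspace T. \<pi> x \<in> S \<inter> U} = {x \<in> topspace T. \<pi> x \<in> S} \<inter> {x \<in> topspace T. \<pi> x \<in> U}"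
    by blast
  with * show "openin T {x \<in> topspace T. \<pi> x \<in> S \<inter> U}"
    by (simp add: openin_Int)
next
  fix K
  assume *: "\<forall>U\<in>K. U \<subseteq> \<pi> ` topspace T \<and> openin T {x \<in> topspace T. \<pi> x \<in> U}"
  then show "\<Union>K \<subseteq> \<pi> ` topspace T"
    by blast
  have "{x \<in> topspace T. \<pi> x \<in> \<Union>K} = (\<Union>U\<in>K. {x \<in> topspace T. \<pi> x \<in> U})"
    by blast
  with * show "openin T {x \<in> topspace T. \<pi> x \<in> \<Union>K}"
    by auto
qed

lemma quotient_map_quotient_top: "quotient_map T (quotient_top T \<pi>) \<pi>"
proof -
  have op: "openin (quotient_top T \<pi>) U \<longleftrightarrow>
      U \<subseteq> \<pi> ` topspace T \<and> openin T {x \<in> topspace T. \<pi> x \<in> U}" for U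
    unfolding quotient_top_def by (simp add: topology_inverse'[OF istopology_quotient])
  have "{x \<in> topspace T. \<pi> x \<in> \<pi> ` topspace T} = topspace T"
    by blast
  then have "openin (quotient_top T \<pi>) (\<pi> ` topspace T)"
    by (simp add: op)
  then have "topspace (quotient_top T \<pi>) = \<pi> ` topspace T"
    using openin_subset op openin_topspace by (metis subset_antisym)
  then show ?thesis
    unfolding quotient_map_def by (simp add: op)
qed

definition quotient_function_space ::
    "'p function_space \<Rightarrow> ('p \<Rightarrow> 'q) \<Rightarrow> 'q function_space" where
  "quotient_function_space S \<pi> =
    \<lparr>top_of = quotient_top (top_of S) \<pi>,
     functions_on = (\<lambda>U. {f. f \<circ> \<pi> \<in> functions_on S {x \<in> topspace (top_of S). \<pi> x \<in> U}})\<rparr>"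

definition function_space_iso ::
    "'p function_space \<Rightarrow> 'q function_space \<Rightarrow> ('p \<Rightarrow> 'q) \<Rightarrow> bool" where
  "function_space_iso S T \<phi> \<longleftrightarrow>
    homeomorphic_map (top_of S) (top_of T) \<phi> \<and>
    (\<forall>U f. openin (top_of T) U \<longrightarrow>
      (f \<in> functions_on T U \<longleftrightarrow> f \<circ> \<phi> \<in> functions_on S {x \<in> topspace (top_of S). \<phi> x \<in> U}))"

definition is_affine :: "'p function_space \<Rightarrow> bool" where
  "is_affine S \<longleftrightarrow>
    (\<exists>m X \<phi>. closedin (zariski m) X \<and> function_space_iso S (affine_function_space m X) \<phi>)"


section \<open>Affine algebraic groups\<close>

locale affine_algebraic_group = group G for n :: nat and G :: "point monoid" (structure) +
  assumes closed: "closedin (zariski n) (carrier G)"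
    and mult_regular: "\<exists>p\<in>poly_functions2. \<forall>x\<in>carrier G. \<forall>y\<in>carrier G. (x \<otimes> y) i = p (x, y)"
    and inv_regular: "\<exists>p\<in>poly_functions. \<forall>x\<in>carrier G. (inv x) i = p x"

definition closed_subgroup :: "nat \<Rightarrow> point monoid \<Rightarrow> point set \<Rightarrow> bool" where
  "closed_subgroup n G H \<longleftrightarrow> subgroup H G \<and> closedin (zariski n) H"

lemma closed_subgroup_algebraic:
  assumes G: "affine_algebraic_group n G" and H: "closed_subgroup n G H"
  shows "affine_algebraic_group n (G\<lparr>carrier := H\<rparr>)"
proof -
  interpret affine_algebraic_group n G by (fact G)
  have sub: "subgroup H G" and cl: "closedin (zariski n) H"
    using H by (auto simp: closed_subgroup_def)
  show ?thesis
  proof (intro affine_algebraic_group.intro affine_algebraic_group_axioms.intro)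
    show "group (G\<lparr>carrier := H\<rparr>)"
      using sub by (rule subgroup_imp_group)
    show "closedin (zariski n) (carrier (G\<lparr>carrier := H\<rparr>))"
      using cl by simp
    show "\<exists>p\<in>poly_functions2. \<forall>x\<in>carrier (G\<lparr>carrier := H\<rparr>). \<forall>y\<in>carrier (G\<lparr>carrier := H\<rparr>).
        (x \<otimes>\<^bsub>G\<lparr>carrier := H\<rparr>\<^esub> y) i = p (x, y)" for i
      using mult_regular[of i] subgroup.mem_carrier[OF sub] by auto
    show "\<exists>p\<in>poly_functions. \<forall>x\<in>carrier (G\<lparr>carrier := H\<rparr>).
        (inv\<^bsub>G\<lparr>carrier := H\<rparr>\<^esub> x) i = p x" for i
      using inv_regular[of i] subgroup.mem_carrier[OF sub] m_inv_consistent[OF sub] by auto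
  qed
qed

text \<open>The quotient variety \<open>G/H\<close>, on the set of left cosets \<open>gH\<close>.\<close>

definition quotient_variety :: "nat \<Rightarrow> point monoid \<Rightarrow> point set \<Rightarrow> point set function_space" where
  "quotient_variety n G H =
    quotient_function_space (affine_function_space n (carrier G)) (\<lambda>g. g <#\<^bsub>G\<^esub> H)"


section \<open>Bialgebras in Sweedler notation\<close>

text \<open>
  \<open>comult A a\<close> is a finite set of pairs \<open>(a\<^sub>1, a\<^sub>2)\<close> with \<open>\<Delta>(a) = \<Sum> a\<^sub>1 \<otimes> a\<^sub>2\<close>, i.e. a chosen
  representative of the tensor \<open>\<Delta>(a)\<close>. (Every tensor is such a sum over pairwise distinct
  pairs.) Below it only occurs in sums of expressions bilinear in \<open>a\<^sub>1, a\<^sub>2\<close>, which do not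
  depend on the choice.
\<close>

record 'a bialgebra = "(complex, 'a) module" +
  comult :: "'a \<Rightarrow> ('a \<times> 'a) set"
  counit :: "'a \<Rightarrow> complex"

definition linear_form :: "'a bialgebra \<Rightarrow> ('a \<Rightarrow> complex) \<Rightarrow> bool" where
  "linear_form A \<chi> \<longleftrightarrow>
    (\<forall>a\<in>carrier A. \<forall>b\<in>carrier A. \<chi> (a \<oplus>\<^bsub>A\<^esub> b) = \<chi> a + \<chi> b) \<and>
    (\<forall>c. \<forall>a\<in>carrier A. \<chi> (c \<odot>\<^bsub>A\<^esub> a) = c * \<chi> a)"

definition convolution :: "'a bialgebra \<Rightarrow> ('a \<Rightarrow> complex) \<Rightarrow> ('a \<Rightarrow> complex) \<Rightarrow> 'a \<Rightarrow> complex" where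
  "convolution A \<chi> \<psi> a = (\<Sum>(a1, a2)\<in>comult A a. \<chi> a1 * \<psi> a2)"

definition convolution_inverse :: "'a bialgebra \<Rightarrow> ('a \<Rightarrow> complex) \<Rightarrow> ('a \<Rightarrow> complex) \<Rightarrow> bool" where
  "convolution_inverse A \<chi> \<psi> \<longleftrightarrow> linear_form A \<psi> \<and>
    (\<forall>a\<in>carrier A. convolution A \<chi> \<psi> a = counit A a \<and> convolution A \<psi> \<chi> a = counit A a)"

text \<open>Linear maps \<open>A \<otimes> A \<rightarrow> \<complex>\<close> are represented by bilinear forms on \<open>A\<close>.\<close>

type_synonym 'a form = "'a \<Rightarrow> 'a \<Rightarrow> complex"

definition bilinear_form :: "'a bialgebra \<Rightarrow> 'a form \<Rightarrow> bool" where
  "bilinear_form A J \<longleftrightarrow>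
    (\<forall>b\<in>carrier A. linear_form A (\<lambda>a. J a b)) \<and> (\<forall>a\<in>carrier A. linear_form A (J a))"

definition convolution2 :: "'a bialgebra \<Rightarrow> 'a form \<Rightarrow> 'a form \<Rightarrow> 'a form" where
  "convolution2 A J K a b =
    (\<Sum>(a1, a2)\<in>comult A a. \<Sum>(b1, b2)\<in>comult A b. J a1 b1 * K a2 b2)"

definition convolution2_inverse :: "'a bialgebra \<Rightarrow> 'a form \<Rightarrow> 'a form \<Rightarrow> bool" where
  "convolution2_inverse A J K \<longleftrightarrow> bilinear_form A K \<and>
    (\<forall>a\<in>carrier A. \<forall>b\<in>carrier A.
      convolution2 A J K a b = counit A a * counit A b \<and>
      convolution2 A K J a b = counit A a * counit A b)"

definition hopf_2cocycle :: "'a bialgebra \<Rightarrow> 'a form \<Rightarrow> bool" where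
  "hopf_2cocycle A J \<longleftrightarrow>
    bilinear_form A J \<and> (\<exists>K. convolution2_inverse A J K) \<and>
    (\<forall>a\<in>carrier A. \<forall>b\<in>carrier A. \<forall>c\<in>carrier A.
      (\<Sum>(a1, a2)\<in>comult A a. \<Sum>(b1, b2)\<in>comult A b. J (a1 \<otimes>\<^bsub>A\<^esub> b1) c * J a2 b2) =
      (\<Sum>(b1, b2)\<in>comult A b. \<Sum>(c1, c2)\<in>comult A c. J a (b1 \<otimes>\<^bsub>A\<^esub> c1) * J b2 c2)) \<and>
    (\<forall>a\<in>carrier A. J a \<one>\<^bsub>A\<^esub> = counit A a \<and> J \<one>\<^bsub>A\<^esub> a = counit A a)"

definition gauge_equivalent :: "'a bialgebra \<Rightarrow> 'a form \<Rightarrow> 'a form \<Rightarrow> bool" where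
  "gauge_equivalent A J J' \<longleftrightarrow>
    (\<exists>\<chi> \<chi>'. linear_form A \<chi> \<and> convolution_inverse A \<chi> \<chi>' \<and> \<chi> \<one>\<^bsub>A\<^esub> = 1 \<and>
      (\<forall>a\<in>carrier A. \<forall>b\<in>carrier A.
        J' a b = convolution2 A (convolution2 A (\<lambda>x y. \<chi> (x \<otimes>\<^bsub>A\<^esub> y)) J) (\<lambda>x y. \<chi>' x * \<chi>' y) a b))"

definition R_form :: "'a bialgebra \<Rightarrow> 'a form \<Rightarrow> 'a form" where
  "R_form A J = convolution2 A (SOME K. convolution2_inverse A (\<lambda>a b. J b a) K) J"

definition minimal_form :: "'a bialgebra \<Rightarrow> 'a form \<Rightarrow> bool" where
  "minimal_form A J \<longleftrightarrow> {a \<in> carrier A. \<forall>b\<in>carrier A. R_form A J b a = 0} = {\<zero>\<^bsub>A\<^esub>}"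

text \<open>The algebra \<open>A\<^sub>J\<close> with multiplication \<open>m\<^sub>J(a \<otimes> b) = \<Sum> a\<^sub>1b\<^sub>1J(a\<^sub>2,b\<^sub>2)\<close>.\<close>

definition twisted_algebra :: "'a bialgebra \<Rightarrow> 'a form \<Rightarrow> (complex, 'a) module" where
  "twisted_algebra A J =
    \<lparr>carrier = carrier A,
     mult = (\<lambda>a b. \<Oplus>\<^bsub>A\<^esub>z\<in>comult A a \<times> comult A b.
                case z of ((a1, a2), (b1, b2)) \<Rightarrow> J a2 b2 \<odot>\<^bsub>A\<^esub> (a1 \<otimes>\<^bsub>A\<^esub> b1)),
     one = \<one>\<^bsub>A\<^esub>, zero = \<zero>\<^bsub>A\<^esub>, add = (\<oplus>\<^bsub>A\<^esub>), smult = (\<odot>\<^bsub>A\<^esub>)\<rparr>"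

definition algebra_center :: "(complex, 'a) module \<Rightarrow> (complex, 'a) module" where
  "algebra_center B = B\<lparr>carrier := {z \<in> carrier B. \<forall>b\<in>carrier B. z \<otimes>\<^bsub>B\<^esub> b = b \<otimes>\<^bsub>B\<^esub> z}\<rparr>"

definition algebra_isomorphic :: "(complex, 'a) module \<Rightarrow> (complex, 'b) module \<Rightarrow> bool" where
  "algebra_isomorphic B C \<longleftrightarrow>
    (\<exists>\<phi>\<in>ring_iso B C. \<forall>c. \<forall>b\<in>carrier B. \<phi> (c \<odot>\<^bsub>B\<^esub> b) = c \<odot>\<^bsub>C\<^esub> \<phi> b)"

definition trivial_algebra :: "(complex, 'a) module \<Rightarrow> bool" where
  "trivial_algebra B \<longleftrightarrow> carrier B = {c \<odot>\<^bsub>B\<^esub> \<one>\<^bsub>B\<^esub> |c. True}"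


section \<open>The Hopf algebra of regular functions\<close>

definition function_algebra :: "point set \<Rightarrow> (point \<Rightarrow> complex) set \<Rightarrow> (complex, point \<Rightarrow> complex) module"
  where "function_algebra X F =
    \<lparr>carrier = F, mult = (\<lambda>f g. \<lambda>x\<in>X. f x * g x), one = (\<lambda>x\<in>X. 1),
     zero = (\<lambda>x\<in>X. 0), add = (\<lambda>f g. \<lambda>x\<in>X. f x + g x), smult = (\<lambda>c f. \<lambda>x\<in>X. c * f x)\<rparr>"

text \<open>
  \<open>represents_comult G a S\<close> says \<open>a(xy) = \<Sum> a\<^sub>1(x) a\<^sub>2(y)\<close>, which is \<open>\<Delta>(a) = \<Sum> a\<^sub>1 \<otimes> a\<^sub>2\<close> under
  \<open>\<O>(G) \<otimes> \<O>(G) = \<O>(G \<times> G)\<close>.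
\<close>

definition represents_comult ::
    "point monoid \<Rightarrow> (point \<Rightarrow> complex) \<Rightarrow> ((point \<Rightarrow> complex) \<times> (point \<Rightarrow> complex)) set \<Rightarrow> bool" where
  "represents_comult G a S \<longleftrightarrow>
    finite S \<and> S \<subseteq> regular_functions (carrier G) \<times> regular_functions (carrier G) \<and>
    (\<forall>x\<in>carrier G. \<forall>y\<in>carrier G. a (x \<otimes>\<^bsub>G\<^esub> y) = (\<Sum>(a1, a2)\<in>S. a1 x * a2 y))"

definition regular_bialgebra :: "point monoid \<Rightarrow> (point \<Rightarrow> complex) bialgebra" where
  "regular_bialgebra G =
    module.extend (function_algebra (carrier G) (regular_functions (carrier G)))
      \<lparr>comult = (\<lambda>a. SOME S. represents_comult G a S), counit = (\<lambda>a. a \<one>\<^bsub>G\<^esub>)\<rparr>"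

lemma regular_bialgebra_simps [simp]:
  "carrier (regular_bialgebra G) = regular_functions (carrier G)"
  "a \<otimes>\<^bsub>regular_bialgebra G\<^esub> b = (\<lambda>x\<in>carrier G. a x * b x)"
  "a \<oplus>\<^bsub>regular_bialgebra G\<^esub> b = (\<lambda>x\<in>carrier G. a x + b x)"
  "c \<odot>\<^bsub>regular_bialgebra G\<^esub> a = (\<lambda>x\<in>carrier G. c * a x)"
  "\<one>\<^bsub>regular_bialgebra G\<^esub> = (\<lambda>x\<in>carrier G. 1)"
  "\<zero>\<^bsub>regular_bialgebra G\<^esub> = (\<lambda>x\<in>carrier G. 0)"
  "comult (regular_bialgebra G) a = (SOME S. represents_comult G a S)"
  "counit (regular_bialgebra G) a = a \<one>\<^bsub>G\<^esub>"
  by (simp_all add: regular_bialgebra_def function_algebra_def module.defs)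

lemma poly_functions2_comp_mult:
  assumes "affine_algebraic_group n G" and "p \<in> poly_functions"
  shows "\<exists>q\<in>poly_functions2. \<forall>x\<in>carrier G. \<forall>y\<in>carrier G. p (x \<otimes>\<^bsub>G\<^esub> y) = q (x, y)"
  using assms(2) unfolding poly_functions_def
proof induction
  case (const c)
  show ?case
    unfolding poly_functions2_def
    by (intro bexI[of _ "\<lambda>_. c"]) (auto intro: generated_functions.const)
next
  case (gen f)
  then show ?case
    using affine_algebraic_group.mult_regular[OF assms(1)] by auto
next
  case (add f g)
  then obtain p q where "p \<in> poly_functions2" "q \<in> poly_functions2"
    "\<forall>x\<in>carrier G. \<forall>y\<in>carrier G. f (x \<otimes>\<^bsub>G\<^esub> y) = p (x, y)"
    "\<forall>x\<in>carrier G. \<forall>y\<in>carrier G. g (x \<otimes>\<^bsub>G\<^esub> y) = q (x, y)"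
    by blast
  then show ?case
    unfolding poly_functions2_def
    by (intro bexI[of _ "\<lambda>z. p z + q z"]) (auto intro: generated_functions.add)
next
  case (mult f g)
  then obtain p q where "p \<in> poly_functions2" "q \<in> poly_functions2"
    "\<forall>x\<in>carrier G. \<forall>y\<in>carrier G. f (x \<otimes>\<^bsub>G\<^esub> y) = p (x, y)"
    "\<forall>x\<in>carrier G. \<forall>y\<in>carrier G. g (x \<otimes>\<^bsub>G\<^esub> y) = q (x, y)"
    by blast
  then show ?case
    unfolding poly_functions2_def
    by (intro bexI[of _ "\<lambda>z. p z * q z"]) (auto intro: generated_functions.mult)
qed

lemma poly_functions2_decompose:
  assumes "q \<in> poly_functions2"
  shows "\<exists>xs. set xs \<subseteq> poly_functions \<times> poly_functions \<and>
    (\<forall>x y. q (x, y) = (\<Sum>(u, v)\<leftarrow>xs. u x * v y))"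
  using assms unfolding poly_functions2_def
proof induction
  case (const c)
  show ?case
    by (rule exI[of _ "[(\<lambda>_. c, \<lambda>_. 1)]"])
       (auto simp: poly_functions_def intro: generated_functions.const)
next
  case (gen f)
  then consider i where "f = (\<lambda>(x, y). x i)" | i where "f = (\<lambda>(x, y). y i)"
    by blast
  then show ?case
  proof cases
    case 1
    then show ?thesis
      by (intro exI[of _ "[(\<lambda>x. x i, \<lambda>_. 1)]"])
         (auto simp: poly_functions_def intro: generated_functions.intros)
  next
    case 2
    then show ?thesis
      by (intro exI[of _ "[(\<lambda>_. 1, \<lambda>x. x i)]"])
         (auto simp: poly_functions_def intro: generated_functions.intros)
  qed
next
  case (add f g)
  then obtain xs ys where "set xs \<subseteq> poly_functions \<times> poly_functions"
    "\<forall>x y. f (x, y) = (\<Sum>(u, v)\<leftarrow>xs. u x * v y)"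
    "set ys \<subseteq> poly_functions \<times> poly_functions"
    "\<forall>x y. g (x, y) = (\<Sum>(u, v)\<leftarrow>ys. u x * v y)"
    by blast
  then show ?case
    by (intro exI[of _ "xs @ ys"]) auto
next
  case (mult f g)
  then obtain xs ys where xs: "set xs \<subseteq> poly_functions \<times> poly_functions"
    "\<forall>x y. f (x, y) = (\<Sum>(u, v)\<leftarrow>xs. u x * v y)"
    and ys: "set ys \<subseteq> poly_functions \<times> poly_functions"
    "\<forall>x y. g (x, y) = (\<Sum>(u, v)\<leftarrow>ys. u x * v y)"
    by blast
  define zs where "zs xs = concat (map (\<lambda>(u, v). map (\<lambda>(u', v').
      (\<lambda>x. u x * u' x, \<lambda>y. v y * v' y)) ys) xs)" for xs :: "((point \<Rightarrow> complex) \<times> (point \<Rightarrow> complex)) list"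
  have inner: "(\<Sum>(u', v')\<leftarrow>map (\<lambda>(u', v'). (\<lambda>x. u x * u' x, \<lambda>y. v y * v' y)) l. u' x * v' y) =
      u x * v y * (\<Sum>(u, v)\<leftarrow>l. u x * v y)"
    for u v x y and l :: "((point \<Rightarrow> complex) \<times> (point \<Rightarrow> complex)) list"
    by (induction l) (auto simp: algebra_simps)
  have "(\<Sum>(u, v)\<leftarrow>zs l. u x * v y) = (\<Sum>(u, v)\<leftarrow>l. u x * v y) * (\<Sum>(u, v)\<leftarrow>ys. u x * v y)"
    for x y l
    by (induction l) (auto simp: zs_def inner algebra_simps simp del: map_map)
  moreover have "set (zs xs) \<subseteq> poly_functions \<times> poly_functions"
    using xs(1) ys(1) by (fastforce simp: zs_def poly_functions_def intro!: generated_functions.mult)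
  ultimately show ?case
    using xs(2) ys(2) by (intro exI[of _ "zs xs"]) auto
qed

lemma regular_functions_sum_list:
  assumes "\<And>u. u \<in> set us \<Longrightarrow> u \<in> regular_functions X"
  shows "(\<lambda>x\<in>X. \<Sum>u\<leftarrow>us. u x) \<in> regular_functions X"
  using assms
proof (induction us)
  case Nil
  show ?case
    unfolding regular_functions_def poly_functions_def
    by (intro image_eqI[of _ _ "\<lambda>_. 0"]) (auto intro: generated_functions.const)
next
  case (Cons u us)
  then obtain p q where "p \<in> poly_functions" "u = restrict p X" "q \<in> poly_functions"
    "(\<lambda>x\<in>X. \<Sum>u\<leftarrow>us. u x) = restrict q X"
    unfolding regular_functions_def by (smt (verit) image_iff list.set_intros)
  moreover from this have "(\<Sum>u\<leftarrow>us. u x) = q x" if "x \<in> X" for x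
    using that by (metis restrict_apply')
  ultimately show ?case
    unfolding regular_functions_def poly_functions_def
    by (intro image_eqI[of _ _ "\<lambda>x. p x + q x"]) (auto intro: generated_functions.add)
qed

lemma represents_comult_comult:
  assumes G: "affine_algebraic_group n G" and a: "a \<in> regular_functions (carrier G)"
  shows "represents_comult G a (comult (regular_bialgebra G) a)"
proof -
  let ?X = "carrier G"
  interpret affine_algebraic_group n G by (fact G)
  obtain p where p: "p \<in> poly_functions" "a = restrict p ?X"
    using a by (auto simp: regular_functions_def)
  obtain xs where xs: "set xs \<subseteq> poly_functions \<times> poly_functions"
    "\<And>x y. x \<in> ?X \<Longrightarrow> y \<in> ?X \<Longrightarrow> p (x \<otimes>\<^bsub>G\<^esub> y) = (\<Sum>(u, v)\<leftarrow>xs. u x * v y)"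
    using poly_functions2_comp_mult[OF G p(1)] poly_functions2_decompose by metis
  define ys where "ys = map (\<lambda>(u, v). (restrict u ?X, restrict v ?X)) xs"
  have ys: "set ys \<subseteq> regular_functions ?X \<times> regular_functions ?X"
    using xs(1) by (fastforce simp: ys_def regular_functions_def)
  have ys_sum: "a (x \<otimes>\<^bsub>G\<^esub> y) = (\<Sum>(u, v)\<leftarrow>ys. u x * v y)" if "x \<in> ?X" "y \<in> ?X" for x y
  proof -
    have "(\<Sum>(u, v)\<leftarrow>xs. u x * v y) = (\<Sum>(u, v)\<leftarrow>ys. u x * v y)"
      using that unfolding ys_def by (induction xs) auto
    then show ?thesis
      using that p(2) xs(2) by simp
  qed
  define c where "c v = (\<lambda>x\<in>?X. \<Sum>u\<leftarrow>map fst (filter (\<lambda>z. snd z = v) ys). u x)" for v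
  define S where "S = (\<lambda>v. (c v, v)) ` snd ` set ys"
  have "c v \<in> regular_functions ?X" for v
    unfolding c_def using ys by (intro regular_functions_sum_list) auto
  then have "S \<subseteq> regular_functions ?X \<times> regular_functions ?X"
    using ys by (auto simp: S_def)
  moreover have "a (x \<otimes>\<^bsub>G\<^esub> y) = (\<Sum>(u, v)\<in>S. u x * v y)" if "x \<in> ?X" "y \<in> ?X" for x y
  proof -
    have *: "(\<Sum>v\<in>V. (\<Sum>u\<leftarrow>map fst (filter (\<lambda>z. snd z = v) zs). u x) * v y) = (\<Sum>(u, v)\<leftarrow>zs. u x * v y)"
      if "finite V" "snd ` set zs \<subseteq> V" for zs :: "((point \<Rightarrow> complex) \<times> (point \<Rightarrow> complex)) list" and V
      using that(2)
    proof (induction zs)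
      case (Cons z zs)
      obtain u w where z: "z = (u, w)" by fastforce
      have "(\<Sum>v\<in>V. (\<Sum>u\<leftarrow>map fst (filter (\<lambda>z. snd z = v) (z # zs)). u x) * v y) =
        (\<Sum>v\<in>V. (if v = w then u x * w y else 0) +
          (\<Sum>u\<leftarrow>map fst (filter (\<lambda>z. snd z = v) zs). u x) * v y)"
        by (intro sum.cong) (auto simp: z algebra_simps)
      also have "\<dots> = u x * w y + (\<Sum>(u, v)\<leftarrow>zs. u x * v y)"
        using Cons that(1) by (simp add: sum.distrib z)
      finally show ?case by (simp add: z)
    qed simp
    have "(\<Sum>(u, v)\<in>S. u x * v y) = (\<Sum>v\<in>snd ` set ys. c v x * v y)"
      unfolding S_def by (subst sum.reindex) (auto simp: inj_on_def)
    also have "\<dots> = (\<Sum>(u, v)\<leftarrow>ys. u x * v y)"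
      using *[of "snd ` set ys" ys] that by (simp add: c_def)
    finally show ?thesis
      using ys_sum that by simp
  qed
  moreover have "finite S"
    by (simp add: S_def)
  ultimately have "represents_comult G a S"
    by (simp add: represents_comult_def)
  then show ?thesis
    by (simp add: someI[of "represents_comult G a"])
qed

text \<open>\<open>\<O>(G/H)\<close>, as the algebra of right \<open>H\<close>-invariant regular functions on \<open>G\<close>.\<close>

definition quotient_functions ::
    "point monoid \<Rightarrow> point set \<Rightarrow> (complex, point \<Rightarrow> complex) module" where
  "quotient_functions G H =
    function_algebra (carrier G)
      {f \<in> regular_functions (carrier G). \<forall>g\<in>carrier G. \<forall>h\<in>H. f (g \<otimes>\<^bsub>G\<^esub> h) = f g}"

text \<open>
  The support of \<open>J\<close> is determined up to conjugation only, so it is a relation between \<open>J\<close> and \<open>H\<close>.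
\<close>

definition is_support :: "nat \<Rightarrow> point monoid \<Rightarrow> (point \<Rightarrow> complex) form \<Rightarrow> point set \<Rightarrow> bool" where
  "is_support n G J H \<longleftrightarrow> closed_subgroup n G H \<and>
    (\<exists>K. hopf_2cocycle (regular_bialgebra (G\<lparr>carrier := H\<rparr>)) K \<and>
         minimal_form (regular_bialgebra (G\<lparr>carrier := H\<rparr>)) K \<and>
         gauge_equivalent (regular_bialgebra G) J (\<lambda>a b. K (restrict a H) (restrict b H)))"

end

theory Submission
  imports Defs "HOL-Library.Function_Algebras"
    "HOL-Computational_Algebra.Fundamental_Theorem_Algebra"
    "HOL-Analysis.Continuum_Not_Denumerable"
begin

text \<open>
  Pointwise, the product of \<open>\<O>(G)\<^sub>J\<close> is \<open>(a \<cdot> b)(x) = J(a(x _), b(x _))\<close>, and a gauge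
  transformation by \<open>\<chi>\<close> induces the algebra isomorphism \<open>a \<mapsto> \<Sum> a\<^sub>1 \<chi>(a\<^sub>2)\<close>, so \<open>J\<close> may be taken
  to be the pullback of a minimal cocycle \<open>K\<close> on \<open>H\<close>. Since \<open>K\<close> is normalised, a right
  \<open>H\<close>-invariant function multiplies as in \<open>\<O>(G)\<close> and is central. Conversely, if \<open>z\<close> is central,
  then \<open>u = z(x _)\<close> restricted to \<open>H\<close> satisfies \<open>K(u(h _), c) = K(c, u(h _))\<close> for all \<open>h\<close> and \<open>c\<close>,
  hence \<open>R\<^sup>K(c, u) = \<epsilon>(c) \<epsilon>(u)\<close>, and minimality makes \<open>u\<close> constant.

  If \<open>G/H\<close> is affine and the center is trivial, the coordinates of \<open>G/H\<close> pull back to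
  \<open>H\<close>-invariant regular functions on \<open>G\<close>, which are constant; so \<open>H = G\<close>, and \<open>J\<close> is gauge
  equivalent to the minimal \<open>K\<close>. Passing from local to global regular functions on \<open>G\<close> needs the
  Nullstellensatz, which over the uncountable field \<open>\<complex>\<close> has a short proof by countable dimension.
\<close>

section \<open>Convolution of forms on the coordinate ring\<close>

text \<open>Each coproduct is available only through a chosen representative, and the
  representatives chosen for different functions are unrelated. Sweedler sums are therefore traded
  for values: a form applied to the translate \<open>a(x _)\<close> depends on no choice, and
  coassociativity becomes associativity of G. Convolution of linear forms turns into composition of
  operators on O(G), and convolution with a product form into substitution of such operators in the
  arguments. The last step of the overview, from K back to J, needs minimality to be gauge
  invariant. As O(G) is commutative, \<open>\<chi> \<circ> m\<close> equals its own flip and cancels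
  in R^J'. What remains is R^J conjugated by \<open>\<chi> \<otimes> \<chi>\<close>, that is, R^J
  with both arguments moved by one linear bijection of O(G).\<close>

declare regular_bialgebra_simps(7) [simp del] \<comment> \<open>it exposes the \<open>SOME\<close> in \<open>comult\<close>\<close>

lemma regular_functions_intros:
  "(\<lambda>x\<in>X. c) \<in> regular_functions X"
  "a \<in> regular_functions X \<Longrightarrow> b \<in> regular_functions X \<Longrightarrow> (\<lambda>x\<in>X. a x + b x) \<in> regular_functions X"
  "a \<in> regular_functions X \<Longrightarrow> b \<in> regular_functions X \<Longrightarrow> (\<lambda>x\<in>X. a x * b x) \<in> regular_functions X"
proof -
  show "(\<lambda>x\<in>X. c) \<in> regular_functions X"
    unfolding regular_functions_def poly_functions_def by (auto intro: generated_functions.const)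
  assume "a \<in> regular_functions X" "b \<in> regular_functions X"
  then obtain p q where pq: "p \<in> poly_functions" "a = restrict p X" "q \<in> poly_functions" "b = restrict q X"
    by (auto simp: regular_functions_def)
  have "(\<lambda>x. p x + q x) \<in> poly_functions" "(\<lambda>x. p x * q x) \<in> poly_functions"
    using pq unfolding poly_functions_def by (auto intro: generated_functions.intros)
  moreover have "(\<lambda>x\<in>X. a x + b x) = restrict (\<lambda>x. p x + q x) X"
    "(\<lambda>x\<in>X. a x * b x) = restrict (\<lambda>x. p x * q x) X"
    using pq by auto
  ultimately show "(\<lambda>x\<in>X. a x + b x) \<in> regular_functions X"
    "(\<lambda>x\<in>X. a x * b x) \<in> regular_functions X"
    unfolding regular_functions_def by (auto simp only: intro!: imageI)
qed

lemma regular_functions_scale: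
  "a \<in> regular_functions X \<Longrightarrow> (\<lambda>x\<in>X. c * a x) \<in> regular_functions X"
  using regular_functions_intros(3)[OF regular_functions_intros(1)[of c X], of a]
  by (simp cong: restrict_cong)

lemma regular_functions_sum:
  "(\<And>i. i \<in> I \<Longrightarrow> f i \<in> regular_functions X) \<Longrightarrow> (\<lambda>x\<in>X. \<Sum>i\<in>I. c i * f i x) \<in> regular_functions X"
proof (induction I rule: infinite_finite_induct)
  case (insert i I)
  then have "(\<lambda>x\<in>X. (\<lambda>x\<in>X. c i * f i x) x + (\<lambda>x\<in>X. \<Sum>i\<in>I. c i * f i x) x) \<in> regular_functions X"
    by (intro regular_functions_intros(2) regular_functions_scale) auto
  also have "(\<lambda>x\<in>X. (\<lambda>x\<in>X. c i * f i x) x + (\<lambda>x\<in>X. \<Sum>i\<in>I. c i * f i x) x) =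
      (\<lambda>x\<in>X. \<Sum>i\<in>insert i I. c i * f i x)"
    using insert.hyps by auto
  finally show ?case .
qed (simp_all add: regular_functions_intros)

lemma restrict_regular_function: "a \<in> regular_functions X \<Longrightarrow> restrict a X = a"
  by (auto simp: regular_functions_def)

text \<open>The inner index sets vary with the outer variables, as
  \<open>comult \<A> (fst z)\<close> does, so a plain swap does not apply. Each inner set depends on
  its own outer variable only; hence both sums of one variable can be made innermost, where
  coassociativity in that variable applies.\<close>

lemma sum_swap_dependent:
  "(\<Sum>x\<in>S. \<Sum>y\<in>T. \<Sum>u\<in>P x. \<Sum>v\<in>Q y. f x y u v) = (\<Sum>y\<in>T. \<Sum>v\<in>Q y. \<Sum>x\<in>S. \<Sum>u\<in>P x. f x y u v)"
proof -
  have "(\<Sum>x\<in>S. \<Sum>y\<in>T. \<Sum>u\<in>P x. \<Sum>v\<in>Q y. f x y u v) = (\<Sum>y\<in>T. \<Sum>x\<in>S. \<Sum>u\<in>P x. \<Sum>v\<in>Q y. f x y u v)"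
    by (rule sum.swap)
  also have "\<dots> = (\<Sum>y\<in>T. \<Sum>x\<in>S. \<Sum>v\<in>Q y. \<Sum>u\<in>P x. f x y u v)"
    by (intro sum.cong refl sum.swap)
  also have "\<dots> = (\<Sum>y\<in>T. \<Sum>v\<in>Q y. \<Sum>x\<in>S. \<Sum>u\<in>P x. f x y u v)"
    by (intro sum.cong refl sum.swap)
  finally show ?thesis .
qed

lemma sum_swap_dependent':
  "(\<Sum>y\<in>T. \<Sum>v\<in>Q y. \<Sum>x\<in>S. \<Sum>u\<in>P x. f x y u v) = (\<Sum>x\<in>S. \<Sum>u\<in>P x. \<Sum>y\<in>T. \<Sum>v\<in>Q y. f x y u v)"
  by (rule trans[OF sum_swap_dependent[symmetric]]) (intro sum.cong refl sum.swap)

lemma bilinear_formD: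
  assumes "bilinear_form B J" "a \<in> carrier B"
  shows "linear_form B (J a)" "linear_form B (\<lambda>b. J b a)"
  using assms by (auto simp: bilinear_form_def)

lemma bilinear_form_flip: "bilinear_form B J \<Longrightarrow> bilinear_form B (\<lambda>a b. J b a)"
  by (simp add: bilinear_form_def)

text \<open>Flipping both forms keeps the order of the convolution: exchanging the two tensor
  factors respects the coproduct of the tensor square, so only the order of summation
  changes.\<close>

lemma convolution2_flip: "convolution2 B (\<lambda>a b. J b a) (\<lambda>a b. K b a) a b = convolution2 B J K b a"
  unfolding convolution2_def case_prod_beta by (rule sum.swap)

lemma convolution2_inverse_flip:
  "convolution2_inverse B J K \<Longrightarrow> convolution2_inverse B (\<lambda>a b. J b a) (\<lambda>a b. K b a)"
  unfolding convolution2_inverse_def convolution2_flip[of B J K] convolution2_flip[of B K J]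
  by (simp only: bilinear_form_flip mult.commute simp_thms ball_simps) auto

text \<open>Justifies the \<open>SOME\<close> in \<open>R_form\<close>: an inverse of J, flipped,
  inverts the flipped J.\<close>

lemma hopf_2cocycle_flip_inverse:
  assumes "hopf_2cocycle B J"
  shows "convolution2_inverse B (\<lambda>a b. J b a) (SOME K. convolution2_inverse B (\<lambda>a b. J b a) K)"
proof -
  obtain K where "convolution2_inverse B J K"
    using assms by (auto simp: hopf_2cocycle_def)
  from someI[of "convolution2_inverse B (\<lambda>a b. J b a)", OF convolution2_inverse_flip[OF this]]
  show ?thesis .
qed

context affine_algebraic_group
begin

section \<open>Linear and bilinear forms on the coordinate ring\<close>

abbreviation coordinate_ring ("\<O>") where "\<O> \<equiv> regular_functions (carrier G)"
abbreviation coordinate_bialgebra ("\<A>") where "\<A> \<equiv> regular_bialgebra G"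

lemma linear_formI:
  assumes "\<And>a b. a \<in> \<O> \<Longrightarrow> b \<in> \<O> \<Longrightarrow> \<chi> (\<lambda>x\<in>carrier G. a x + b x) = \<chi> a + \<chi> b"
    and "\<And>c a. a \<in> \<O> \<Longrightarrow> \<chi> (\<lambda>x\<in>carrier G. c * a x) = c * \<chi> a"
  shows "linear_form \<A> \<chi>"
  unfolding linear_form_def regular_bialgebra_simps using assms by blast

lemma linear_formD:
  assumes "linear_form \<A> \<chi>" "a \<in> \<O>"
  shows "b \<in> \<O> \<Longrightarrow> \<chi> (\<lambda>x\<in>carrier G. a x + b x) = \<chi> a + \<chi> b"
    and "\<chi> (\<lambda>x\<in>carrier G. c * a x) = c * \<chi> a"
  using assms by (auto simp: linear_form_def)

lemma linear_form_zero:
  assumes "linear_form \<A> \<chi>"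
  shows "\<chi> (\<lambda>x\<in>carrier G. 0) = 0"
  using linear_formD(2)[OF assms regular_functions_intros(1), of 0 0] by (simp cong: restrict_cong)

lemma linear_form_sum:
  assumes "linear_form \<A> \<chi>" "\<And>i. i \<in> I \<Longrightarrow> f i \<in> \<O>"
  shows "\<chi> (\<lambda>x\<in>carrier G. \<Sum>i\<in>I. c i * f i x) = (\<Sum>i\<in>I. c i * \<chi> (f i))"
  using assms(2)
proof (induction I rule: infinite_finite_induct)
  case (insert i I)
  have "(\<lambda>x\<in>carrier G. \<Sum>i\<in>insert i I. c i * f i x) =
      (\<lambda>x\<in>carrier G. (\<lambda>x\<in>carrier G. c i * f i x) x + (\<lambda>x\<in>carrier G. \<Sum>i\<in>I. c i * f i x) x)"
    using insert.hyps by auto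
  moreover have "\<chi> \<dots> = \<chi> (\<lambda>x\<in>carrier G. c i * f i x) + \<chi> (\<lambda>x\<in>carrier G. \<Sum>i\<in>I. c i * f i x)"
    using insert.prems
    by (intro linear_formD(1)[OF assms(1)] regular_functions_scale regular_functions_sum) auto
  moreover have "\<chi> (\<lambda>x\<in>carrier G. c i * f i x) = c i * \<chi> (f i)"
    using insert.prems by (intro linear_formD(2)[OF assms(1)]) simp
  moreover have "\<chi> (\<lambda>x\<in>carrier G. \<Sum>i\<in>I. c i * f i x) = (\<Sum>i\<in>I. c i * \<chi> (f i))"
    using insert.IH insert.prems by blast
  ultimately show ?case
    by (simp only: sum.insert[OF insert.hyps])
qed (simp_all add: linear_form_zero[OF assms(1)])

lemma linear_form_eval: "x \<in> carrier G \<Longrightarrow> linear_form \<A> (\<lambda>a. a x)"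
  by (simp add: linear_form_def)

lemma bilinear_form_sum:
  assumes "bilinear_form \<A> J" "\<And>i. i \<in> I \<Longrightarrow> f i \<in> \<O>" "\<And>j. j \<in> K \<Longrightarrow> g j \<in> \<O>"
  shows "J (\<lambda>x\<in>carrier G. \<Sum>i\<in>I. c i * f i x) (\<lambda>x\<in>carrier G. \<Sum>j\<in>K. d j * g j x) =
    (\<Sum>i\<in>I. \<Sum>j\<in>K. c i * d j * J (f i) (g j))"
proof -
  have "(\<lambda>x\<in>carrier G. \<Sum>j\<in>K. d j * g j x) \<in> \<O>"
    using assms(3) by (rule regular_functions_sum)
  then have "J (\<lambda>x\<in>carrier G. \<Sum>i\<in>I. c i * f i x) (\<lambda>x\<in>carrier G. \<Sum>j\<in>K. d j * g j x) =
      (\<Sum>i\<in>I. c i * J (f i) (\<lambda>x\<in>carrier G. \<Sum>j\<in>K. d j * g j x))"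
    using linear_form_sum[OF bilinear_formD(2)[OF assms(1)], OF _ assms(2)] by simp
  also have "\<dots> = (\<Sum>i\<in>I. c i * (\<Sum>j\<in>K. d j * J (f i) (g j)))"
    using assms(2) by (intro sum.cong refl arg_cong2[of _ _ _ _ "(*)"]
        linear_form_sum[OF bilinear_formD(1)[OF assms(1)]] assms(3)) simp_all
  finally show ?thesis
    by (simp add: sum_distrib_left mult.assoc)
qed

lemma finite_comult: "a \<in> \<O> \<Longrightarrow> finite (comult \<A> a)"
  and comult_regular: "a \<in> \<O> \<Longrightarrow> z \<in> comult \<A> a \<Longrightarrow> fst z \<in> \<O> \<and> snd z \<in> \<O>"
  and comult_apply: "a \<in> \<O> \<Longrightarrow> x \<in> carrier G \<Longrightarrow> y \<in> carrier G \<Longrightarrow>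
    a (x \<otimes> y) = (\<Sum>z\<in>comult \<A> a. fst z x * snd z y)"
  using represents_comult_comult[OF affine_algebraic_group_axioms, of a]
  by (auto simp: represents_comult_def case_prod_beta)

section \<open>Translations and the action of linear forms\<close>

definition left_translate :: "point \<Rightarrow> (point \<Rightarrow> complex) \<Rightarrow> point \<Rightarrow> complex" where
  "left_translate x a = (\<lambda>y\<in>carrier G. a (x \<otimes> y))"

definition right_translate :: "point \<Rightarrow> (point \<Rightarrow> complex) \<Rightarrow> point \<Rightarrow> complex" where
  "right_translate y a = (\<lambda>x\<in>carrier G. a (x \<otimes> y))"

text \<open>In Sweedler notation, \<open>left_act \<psi> a = \<Sum> a\<^sub>1 \<psi>(a\<^sub>2)\<close> and \<open>right_act \<chi> a = \<Sum> \<chi>(a\<^sub>1) a\<^sub>2\<close>.\<close>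

definition left_act :: "((point \<Rightarrow> complex) \<Rightarrow> complex) \<Rightarrow> (point \<Rightarrow> complex) \<Rightarrow> point \<Rightarrow> complex" where
  "left_act \<psi> a = (\<lambda>x\<in>carrier G. \<psi> (left_translate x a))"

definition right_act :: "((point \<Rightarrow> complex) \<Rightarrow> complex) \<Rightarrow> (point \<Rightarrow> complex) \<Rightarrow> point \<Rightarrow> complex" where
  "right_act \<chi> a = (\<lambda>y\<in>carrier G. \<chi> (right_translate y a))"

text \<open>The representative chosen for the coproduct of a product has nothing to do with those of
  its factors. Sum formulas are therefore stated for any family representing the coproduct, so that
  products of two chosen families can serve too.\<close>

definition coproduct_sum ::
    "(point \<Rightarrow> complex) \<Rightarrow> 'i set \<Rightarrow> ('i \<Rightarrow> point \<Rightarrow> complex) \<Rightarrow> ('i \<Rightarrow> point \<Rightarrow> complex) \<Rightarrow> bool" where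
  "coproduct_sum a I u v \<longleftrightarrow> (\<forall>i\<in>I. u i \<in> \<O> \<and> v i \<in> \<O>) \<and>
    (\<forall>x\<in>carrier G. \<forall>y\<in>carrier G. a (x \<otimes> y) = (\<Sum>i\<in>I. u i x * v i y))"

lemma coproduct_sum_comult: "a \<in> \<O> \<Longrightarrow> coproduct_sum a (comult \<A> a) fst snd"
  by (simp add: coproduct_sum_def comult_regular comult_apply)

lemma left_translate_sum:
  "coproduct_sum a I u v \<Longrightarrow> x \<in> carrier G \<Longrightarrow>
    left_translate x a = (\<lambda>y\<in>carrier G. \<Sum>i\<in>I. u i x * v i y)"
  by (auto simp: left_translate_def coproduct_sum_def)

lemma right_translate_sum:
  "coproduct_sum a I u v \<Longrightarrow> y \<in> carrier G \<Longrightarrow>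
    right_translate y a = (\<lambda>x\<in>carrier G. \<Sum>i\<in>I. v i y * u i x)"
  by (auto simp: right_translate_def coproduct_sum_def mult.commute)

lemma left_translate_closed: "a \<in> \<O> \<Longrightarrow> x \<in> carrier G \<Longrightarrow> left_translate x a \<in> \<O>"
  using left_translate_sum[OF coproduct_sum_comult, of a x] comult_regular[of a]
  by (simp add: regular_functions_sum)

lemma right_translate_closed: "a \<in> \<O> \<Longrightarrow> x \<in> carrier G \<Longrightarrow> right_translate x a \<in> \<O>"
  using right_translate_sum[OF coproduct_sum_comult, of a x] comult_regular[of a]
  by (simp add: regular_functions_sum)

lemma left_act_sum:
  assumes "linear_form \<A> \<psi>" "coproduct_sum a I u v"
  shows "left_act \<psi> a = (\<lambda>x\<in>carrier G. \<Sum>i\<in>I. \<psi> (v i) * u i x)"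
proof -
  have "\<psi> (left_translate x a) = (\<Sum>i\<in>I. \<psi> (v i) * u i x)" if "x \<in> carrier G" for x
    unfolding left_translate_sum[OF assms(2) that]
    using assms(2) by (subst linear_form_sum[OF assms(1)]) (auto simp: coproduct_sum_def mult.commute)
  then show ?thesis
    by (auto simp: left_act_def)
qed

lemma right_act_sum:
  assumes "linear_form \<A> \<chi>" "coproduct_sum a I u v"
  shows "right_act \<chi> a = (\<lambda>y\<in>carrier G. \<Sum>i\<in>I. \<chi> (u i) * v i y)"
proof -
  have "\<chi> (right_translate y a) = (\<Sum>i\<in>I. \<chi> (u i) * v i y)" if "y \<in> carrier G" for y
    unfolding right_translate_sum[OF assms(2) that]
    using assms(2) by (subst linear_form_sum[OF assms(1)]) (auto simp: coproduct_sum_def mult.commute)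
  then show ?thesis
    by (auto simp: right_act_def)
qed

lemmas left_act_comult = left_act_sum[OF _ coproduct_sum_comult]
lemmas right_act_comult = right_act_sum[OF _ coproduct_sum_comult]

lemma left_act_closed: "linear_form \<A> \<psi> \<Longrightarrow> a \<in> \<O> \<Longrightarrow> left_act \<psi> a \<in> \<O>"
  by (simp add: left_act_comult regular_functions_sum comult_regular)

lemma right_act_closed: "linear_form \<A> \<chi> \<Longrightarrow> a \<in> \<O> \<Longrightarrow> right_act \<chi> a \<in> \<O>"
  by (simp add: right_act_comult regular_functions_sum comult_regular)

lemma
  assumes "linear_form \<A> \<chi>" "linear_form \<A> \<psi>" "coproduct_sum a I u v"
  shows left_act_form: "\<chi> (left_act \<psi> a) = (\<Sum>i\<in>I. \<chi> (u i) * \<psi> (v i))"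
    and right_act_form: "\<psi> (right_act \<chi> a) = (\<Sum>i\<in>I. \<chi> (u i) * \<psi> (v i))"
  using assms(3)
  unfolding left_act_sum[OF assms(2,3)] right_act_sum[OF assms(1,3)]
  by (auto simp: coproduct_sum_def mult.commute linear_form_sum[OF assms(1)] linear_form_sum[OF assms(2)])

text \<open>These remove the chosen representative from a convolution: the right-hand sides involve
  only values on translates.\<close>

lemma
  assumes "linear_form \<A> \<chi>" "linear_form \<A> \<psi>" "a \<in> \<O>"
  shows convolution_left_act: "convolution \<A> \<chi> \<psi> a = \<chi> (left_act \<psi> a)"
    and convolution_right_act: "convolution \<A> \<chi> \<psi> a = \<psi> (right_act \<chi> a)"
  using left_act_form[OF assms(1,2) coproduct_sum_comult[OF assms(3)]]
    right_act_form[OF assms(1,2) coproduct_sum_comult[OF assms(3)]]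
  by (simp_all add: convolution_def case_prod_beta)

lemma left_act_add:
  assumes "linear_form \<A> \<psi>" "a \<in> \<O>" "b \<in> \<O>"
  shows "left_act \<psi> (\<lambda>x\<in>carrier G. a x + b x) = (\<lambda>x\<in>carrier G. left_act \<psi> a x + left_act \<psi> b x)"
proof -
  have "left_translate x (\<lambda>x\<in>carrier G. a x + b x) =
    (\<lambda>y\<in>carrier G. left_translate x a y + left_translate x b y)" if "x \<in> carrier G" for x
    using that by (auto simp: left_translate_def)
  then show ?thesis
    using assms linear_formD(1)[OF assms(1)] left_translate_closed by (auto simp: left_act_def)
qed

lemma left_act_scale:
  assumes "linear_form \<A> \<psi>" "a \<in> \<O>"
  shows "left_act \<psi> (\<lambda>x\<in>carrier G. c * a x) = (\<lambda>x\<in>carrier G. c * left_act \<psi> a x)"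
proof -
  have "left_translate x (\<lambda>x\<in>carrier G. c * a x) =
    (\<lambda>y\<in>carrier G. c * left_translate x a y)" if "x \<in> carrier G" for x
    using that by (auto simp: left_translate_def)
  then show ?thesis
    using assms linear_formD(2)[OF assms(1)] left_translate_closed by (auto simp: left_act_def)
qed

lemma linear_form_cong:
  assumes "linear_form \<A> \<chi>" "\<And>a. a \<in> \<O> \<Longrightarrow> \<psi> a = \<chi> a"
  shows "linear_form \<A> \<psi>"
  using assms by (auto simp: linear_form_def regular_functions_intros regular_functions_scale)

lemma linear_form_convolution:
  assumes "linear_form \<A> \<chi>" "linear_form \<A> \<psi>"
  shows "linear_form \<A> (convolution \<A> \<chi> \<psi>)"
proof (rule linear_form_cong)
  show "linear_form \<A> (\<lambda>a. \<chi> (left_act \<psi> a))"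
    using assms
    by (intro linear_formI) (simp_all add: left_act_add left_act_scale linear_formD[OF assms(1)] left_act_closed)
qed (simp add: convolution_left_act assms)

text \<open>When \<psi> is evaluation at y, \<open>left_act \<psi>\<close> is right translation by
  y. For every \<psi> it still commutes with left translations, by associativity of G.\<close>

lemma left_act_left_translate:
  "x \<in> carrier G \<Longrightarrow> left_act \<psi> (left_translate x a) = left_translate x (left_act \<psi> a)"
  by (auto simp: left_act_def left_translate_def fun_eq_iff m_assoc cong: restrict_cong)

lemma right_act_right_translate:
  "x \<in> carrier G \<Longrightarrow> right_act \<psi> (right_translate x a) = right_translate x (right_act \<psi> a)"
  by (auto simp: right_act_def right_translate_def fun_eq_iff m_assoc cong: restrict_cong)

text \<open>Convolution becomes composition of operators, in the same order here and in reversed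
  order for \<open>right_act\<close>. Associativity of convolution is then inherited from
  composition, and a convolution inverse gives an inverse operator.\<close>

lemma left_act_convolution:
  assumes "linear_form \<A> \<chi>" "linear_form \<A> \<psi>" "a \<in> \<O>"
  shows "left_act (convolution \<A> \<chi> \<psi>) a = left_act \<chi> (left_act \<psi> a)"
  using assms
  by (simp add: left_act_def[of "convolution \<A> \<chi> \<psi>"] left_act_def[of \<chi>] convolution_left_act
      left_act_left_translate left_translate_closed cong: restrict_cong)

lemma right_act_convolution:
  assumes "linear_form \<A> \<chi>" "linear_form \<A> \<psi>" "a \<in> \<O>"
  shows "right_act (convolution \<A> \<chi> \<psi>) a = right_act \<psi> (right_act \<chi> a)"
  using assms
  by (simp add: right_act_def[of "convolution \<A> \<chi> \<psi>"] right_act_def[of \<psi>] convolution_right_act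
      right_act_right_translate right_translate_closed cong: restrict_cong)

lemma convolution_assoc:
  assumes "linear_form \<A> \<chi>" "linear_form \<A> \<psi>" "linear_form \<A> \<omega>" "a \<in> \<O>"
  shows "convolution \<A> (convolution \<A> \<chi> \<psi>) \<omega> a = convolution \<A> \<chi> (convolution \<A> \<psi> \<omega>) a"
  using assms by (simp add: convolution_left_act linear_form_convolution left_act_closed left_act_convolution)

lemma left_act_cong:
  assumes "a \<in> \<O>" "\<And>b. b \<in> \<O> \<Longrightarrow> \<psi> b = \<psi>' b"
  shows "left_act \<psi> a = left_act \<psi>' a"
  using assms left_translate_closed by (auto simp: left_act_def)

lemma right_act_cong:
  assumes "a \<in> \<O>" "\<And>b. b \<in> \<O> \<Longrightarrow> \<psi> b = \<psi>' b"
  shows "right_act \<psi> a = right_act \<psi>' a"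
  using assms right_translate_closed by (auto simp: right_act_def)

lemma left_act_counit: "a \<in> \<O> \<Longrightarrow> left_act (\<lambda>a. a \<one>) a = a"
  using restrict_regular_function[of a "carrier G"]
  by (auto simp: left_act_def left_translate_def cong: restrict_cong)

lemma right_act_counit: "a \<in> \<O> \<Longrightarrow> right_act (\<lambda>a. a \<one>) a = a"
  using restrict_regular_function[of a "carrier G"]
  by (auto simp: right_act_def right_translate_def cong: restrict_cong)

text \<open>This is \<open>convolution_assoc\<close> with the chosen representatives written out.
  Testing against three linear forms replaces an identity between tensors.\<close>

lemma coassociativity:
  assumes "linear_form \<A> \<chi>" "linear_form \<A> \<psi>" "linear_form \<A> \<omega>" "a \<in> \<O>"
  shows "(\<Sum>z\<in>comult \<A> a. \<Sum>w\<in>comult \<A> (fst z). \<chi> (fst w) * \<psi> (snd w) * \<omega> (snd z)) =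
    (\<Sum>z\<in>comult \<A> a. \<Sum>w\<in>comult \<A> (snd z). \<chi> (fst z) * \<psi> (fst w) * \<omega> (snd w))"
  using convolution_assoc[OF assms]
  by (simp add: convolution_def case_prod_beta sum_distrib_left sum_distrib_right mult.assoc)

section \<open>Convolution of bilinear forms\<close>

lemma convolution2_assoc:
  assumes "bilinear_form \<A> J" "bilinear_form \<A> K" "bilinear_form \<A> L" "a \<in> \<O>" "b \<in> \<O>"
  shows "convolution2 \<A> (convolution2 \<A> J K) L a b = convolution2 \<A> J (convolution2 \<A> K L) a b"
proof -
  \<comment> \<open>Coassociativity is used in one argument at a time, with the entries belonging to
    the other argument frozen; the swaps below bring the sums of the active argument
    innermost.\<close>
  have a: "(\<Sum>z\<in>comult \<A> a. \<Sum>z'\<in>comult \<A> (fst z). J (fst z') u * K (snd z') v * L (snd z) w) =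
      (\<Sum>z\<in>comult \<A> a. \<Sum>z'\<in>comult \<A> (snd z). J (fst z) u * K (fst z') v * L (snd z') w)"
    if "u \<in> \<O>" "v \<in> \<O>" "w \<in> \<O>" for u v w
    using that assms(1-4)
      coassociativity[of "\<lambda>x. J x u" "\<lambda>x. K x v" "\<lambda>x. L x w"] by (simp add: bilinear_form_def)
  have b: "(\<Sum>z\<in>comult \<A> b. \<Sum>z'\<in>comult \<A> (fst z). J u (fst z') * K v (snd z') * L w (snd z)) =
      (\<Sum>z\<in>comult \<A> b. \<Sum>z'\<in>comult \<A> (snd z). J u (fst z) * K v (fst z') * L w (snd z'))"
    if "u \<in> \<O>" "v \<in> \<O>" "w \<in> \<O>" for u v w
    using that assms(1-3,5)
      coassociativity[of "J u" "K v" "L w"] by (simp add: bilinear_form_def)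
  have "convolution2 \<A> (convolution2 \<A> J K) L a b =
    (\<Sum>z\<in>comult \<A> a. \<Sum>w\<in>comult \<A> b. \<Sum>z'\<in>comult \<A> (fst z). \<Sum>w'\<in>comult \<A> (fst w).
      J (fst z') (fst w') * K (snd z') (snd w') * L (snd z) (snd w))"
    by (simp add: convolution2_def case_prod_beta sum_distrib_right)
  also have "\<dots> = (\<Sum>w\<in>comult \<A> b. \<Sum>w'\<in>comult \<A> (fst w). \<Sum>z\<in>comult \<A> a. \<Sum>z'\<in>comult \<A> (fst z).
      J (fst z') (fst w') * K (snd z') (snd w') * L (snd z) (snd w))"
    by (rule sum_swap_dependent)
  also have "\<dots> = (\<Sum>w\<in>comult \<A> b. \<Sum>w'\<in>comult \<A> (fst w). \<Sum>z\<in>comult \<A> a. \<Sum>z'\<in>comult \<A> (snd z).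
      J (fst z) (fst w') * K (fst z') (snd w') * L (snd z') (snd w))"
    by (rule sum.cong[OF refl], rule sum.cong[OF refl], rule a)
      (use assms(5) comult_regular in blast)+
  also have "\<dots> = (\<Sum>z\<in>comult \<A> a. \<Sum>z'\<in>comult \<A> (snd z). \<Sum>w\<in>comult \<A> b. \<Sum>w'\<in>comult \<A> (fst w).
      J (fst z) (fst w') * K (fst z') (snd w') * L (snd z') (snd w))"
    by (rule sum_swap_dependent')
  also have "\<dots> = (\<Sum>z\<in>comult \<A> a. \<Sum>z'\<in>comult \<A> (snd z). \<Sum>w\<in>comult \<A> b. \<Sum>w'\<in>comult \<A> (snd w).
      J (fst z) (fst w) * K (fst z') (fst w') * L (snd z') (snd w'))"
    by (rule sum.cong[OF refl], rule sum.cong[OF refl], rule b)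
      (use assms(4) comult_regular in blast)+
  also have "\<dots> = (\<Sum>z\<in>comult \<A> a. \<Sum>w\<in>comult \<A> b. \<Sum>z'\<in>comult \<A> (snd z). \<Sum>w'\<in>comult \<A> (snd w).
      J (fst z) (fst w) * K (fst z') (fst w') * L (snd z') (snd w'))"
    by (intro sum.cong refl sum.swap)
  also have "\<dots> = convolution2 \<A> J (convolution2 \<A> K L) a b"
    by (simp add: convolution2_def case_prod_beta sum_distrib_left mult.assoc)
  finally show ?thesis .
qed

lemma convolution2_cong:
  assumes "a \<in> \<O>" "b \<in> \<O>" "\<And>u v. u \<in> \<O> \<Longrightarrow> v \<in> \<O> \<Longrightarrow> J u v = J' u v"
    "\<And>u v. u \<in> \<O> \<Longrightarrow> v \<in> \<O> \<Longrightarrow> K u v = K' u v"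
  shows "convolution2 \<A> J K a b = convolution2 \<A> J' K' a b"
  using assms comult_regular unfolding convolution2_def
  by (intro sum.cong) (auto simp: case_prod_beta)

lemma linear_form_finite_sum:
  assumes "\<And>i. i \<in> I \<Longrightarrow> linear_form \<A> (f i)"
  shows "linear_form \<A> (\<lambda>a. \<Sum>i\<in>I. f i a)"
  using assms by (intro linear_formI) (simp_all add: linear_formD[OF assms] sum.distrib sum_distrib_left)

text \<open>Expanding a single argument leaves a sum of one-variable convolutions in the other, so
  facts about linear forms carry over to each argument separately.\<close>

lemma convolution2_convolution:
  shows "convolution2 \<A> J K a b = (\<Sum>w\<in>comult \<A> b. convolution \<A> (\<lambda>u. J u (fst w)) (\<lambda>u. K u (snd w)) a)"
    and "convolution2 \<A> J K a b = (\<Sum>z\<in>comult \<A> a. convolution \<A> (J (fst z)) (K (snd z)) b)"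
  unfolding convolution2_def convolution_def case_prod_beta
  by (rule sum.swap) (rule refl)

lemma bilinear_form_convolution2:
  assumes "bilinear_form \<A> J" "bilinear_form \<A> K"
  shows "bilinear_form \<A> (convolution2 \<A> J K)"
  unfolding bilinear_form_def
proof (intro conjI ballI)
  fix b assume "b \<in> carrier \<A>"
  then show "linear_form \<A> (\<lambda>a. convolution2 \<A> J K a b)"
    unfolding convolution2_convolution(1)
    using comult_regular bilinear_formD[OF assms(1)] bilinear_formD[OF assms(2)]
    by (intro linear_form_finite_sum linear_form_convolution) auto
next
  fix a assume "a \<in> carrier \<A>"
  then have "linear_form \<A> (\<lambda>b. convolution2 \<A> J K a b)"
    unfolding convolution2_convolution(2)
    using comult_regular bilinear_formD[OF assms(1)] bilinear_formD[OF assms(2)]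
    by (intro linear_form_finite_sum linear_form_convolution) auto
  then show "linear_form \<A> (convolution2 \<A> J K a)"
    by simp
qed

lemma bilinear_form_product:
  assumes "linear_form \<A> \<chi>" "linear_form \<A> \<psi>"
  shows "bilinear_form \<A> (\<lambda>a b. \<chi> a * \<psi> b)"
  unfolding bilinear_form_def
  by (intro conjI ballI linear_formI)
    (simp_all only: linear_formD[OF assms(1)] linear_formD[OF assms(2)] distrib_left distrib_right
      mult.assoc mult.left_commute[of "\<chi> _"])

lemma bilinear_form_cong:
  assumes "bilinear_form \<A> J" "\<And>a b. a \<in> \<O> \<Longrightarrow> b \<in> \<O> \<Longrightarrow> K a b = J a b"
  shows "bilinear_form \<A> K"
  unfolding bilinear_form_def
proof (intro conjI ballI)
  fix b assume "b \<in> carrier \<A>"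
  then show "linear_form \<A> (\<lambda>a. K a b)"
    using bilinear_formD(2)[OF assms(1)] assms(2) by - (rule linear_form_cong[of "\<lambda>a. J a b"], simp_all)
next
  fix a assume "a \<in> carrier \<A>"
  then show "linear_form \<A> (K a)"
    using bilinear_formD(1)[OF assms(1)] assms(2) by - (rule linear_form_cong[of "J a"], simp_all)
qed

text \<open>A product form acts by substitution: through \<open>left_act\<close> when convolved from
  the right, through \<open>right_act\<close> when convolved from the left. This is how the outer
  factor of a gauge transformation is moved into the arguments.\<close>

lemma convolution2_product_right:
  assumes "bilinear_form \<A> J" "linear_form \<A> \<chi>" "linear_form \<A> \<psi>" "a \<in> \<O>" "b \<in> \<O>"
  shows "convolution2 \<A> J (\<lambda>a b. \<chi> a * \<psi> b) a b = J (left_act \<chi> a) (left_act \<psi> b)"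
proof -
  have "J (left_act \<chi> a) (left_act \<psi> b) =
      (\<Sum>z\<in>comult \<A> a. \<Sum>w\<in>comult \<A> b. \<chi> (snd z) * \<psi> (snd w) * J (fst z) (fst w))"
    unfolding left_act_comult[OF assms(2,4)] left_act_comult[OF assms(3,5)]
    using assms(4,5) comult_regular by (intro bilinear_form_sum[OF assms(1)]) blast+
  then show ?thesis
    by (simp add: convolution2_def case_prod_beta mult_ac)
qed

lemma convolution2_product_left:
  assumes "bilinear_form \<A> J" "linear_form \<A> \<chi>" "linear_form \<A> \<psi>" "a \<in> \<O>" "b \<in> \<O>"
  shows "convolution2 \<A> (\<lambda>a b. \<chi> a * \<psi> b) J a b = J (right_act \<chi> a) (right_act \<psi> b)"
proof -
  have "J (right_act \<chi> a) (right_act \<psi> b) =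
      (\<Sum>z\<in>comult \<A> a. \<Sum>w\<in>comult \<A> b. \<chi> (fst z) * \<psi> (fst w) * J (snd z) (snd w))"
    unfolding right_act_comult[OF assms(2,4)] right_act_comult[OF assms(3,5)]
    using assms(4,5) comult_regular by (intro bilinear_form_sum[OF assms(1)]) blast+
  then show ?thesis
    by (simp add: convolution2_def case_prod_beta mult_ac)
qed

text \<open>Rests on multiplicativity of the coproduct: the products of the two chosen families
  represent the coproduct of ab. Applied to a convolution inverse of \<chi>, it makes
  \<open>\<chi> \<circ> m\<close> invertible.\<close>

lemma convolution2_mult:
  assumes "linear_form \<A> \<chi>" "linear_form \<A> \<psi>" "a \<in> \<O>" "b \<in> \<O>"
  shows "convolution2 \<A> (\<lambda>a b. \<chi> (a \<otimes>\<^bsub>\<A>\<^esub> b)) (\<lambda>a b. \<psi> (a \<otimes>\<^bsub>\<A>\<^esub> b)) a b =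
    convolution \<A> \<chi> \<psi> (a \<otimes>\<^bsub>\<A>\<^esub> b)"
proof -
  have "convolution \<A> \<chi> \<psi> (a \<otimes>\<^bsub>\<A>\<^esub> b) = \<chi> (left_act \<psi> (a \<otimes>\<^bsub>\<A>\<^esub> b))"
    using assms by (intro convolution_left_act) (simp_all add: regular_functions_intros)
  also have "\<dots> = (\<Sum>p\<in>comult \<A> a \<times> comult \<A> b.
      \<chi> (fst (fst p) \<otimes>\<^bsub>\<A>\<^esub> fst (snd p)) * \<psi> (snd (fst p) \<otimes>\<^bsub>\<A>\<^esub> snd (snd p)))"
  proof (rule left_act_form[OF assms(1,2)])
    show "coproduct_sum (a \<otimes>\<^bsub>\<A>\<^esub> b) (comult \<A> a \<times> comult \<A> b)
        (\<lambda>p. fst (fst p) \<otimes>\<^bsub>\<A>\<^esub> fst (snd p)) (\<lambda>p. snd (fst p) \<otimes>\<^bsub>\<A>\<^esub> snd (snd p))"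
      unfolding coproduct_sum_def
    proof (intro conjI ballI)
      fix x y assume xy: "x \<in> carrier G" "y \<in> carrier G"
      show "(a \<otimes>\<^bsub>\<A>\<^esub> b) (x \<otimes> y) = (\<Sum>p\<in>comult \<A> a \<times> comult \<A> b.
          (fst (fst p) \<otimes>\<^bsub>\<A>\<^esub> fst (snd p)) x * (snd (fst p) \<otimes>\<^bsub>\<A>\<^esub> snd (snd p)) y)"
        using xy comult_apply[OF assms(3) xy] comult_apply[OF assms(4) xy]
        by (simp add: sum_product sum.cartesian_product case_prod_beta mult_ac)
    next
      fix p assume "p \<in> comult \<A> a \<times> comult \<A> b"
      then show "fst (fst p) \<otimes>\<^bsub>\<A>\<^esub> fst (snd p) \<in> \<O>" "snd (fst p) \<otimes>\<^bsub>\<A>\<^esub> snd (snd p) \<in> \<O>"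
        using comult_regular[OF assms(3)] comult_regular[OF assms(4)]
        by (auto intro!: regular_functions_intros)
    qed
  qed
  finally show ?thesis
    by (simp add: convolution2_def case_prod_beta sum.cartesian_product)
qed

lemma bilinear_form_mult:
  assumes "linear_form \<A> \<chi>"
  shows "bilinear_form \<A> (\<lambda>a b. \<chi> (a \<otimes>\<^bsub>\<A>\<^esub> b))"
proof -
  have lin: "linear_form \<A> (\<lambda>a. \<chi> (\<lambda>x\<in>carrier G. a x * b x))" if b: "b \<in> \<O>" for b
  proof (rule linear_formI)
    fix a a' assume a: "a \<in> \<O>" "a' \<in> \<O>"
    have "(\<lambda>x\<in>carrier G. (\<lambda>x\<in>carrier G. a x + a' x) x * b x) =
        (\<lambda>x\<in>carrier G. (\<lambda>x\<in>carrier G. a x * b x) x + (\<lambda>x\<in>carrier G. a' x * b x) x)"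
      by (auto simp: algebra_simps)
    then show "\<chi> (\<lambda>x\<in>carrier G. (\<lambda>x\<in>carrier G. a x + a' x) x * b x) =
        \<chi> (\<lambda>x\<in>carrier G. a x * b x) + \<chi> (\<lambda>x\<in>carrier G. a' x * b x)"
      using linear_formD(1)[OF assms regular_functions_intros(3)[OF a(1) b] regular_functions_intros(3)[OF a(2) b]]
      by simp
  next
    fix c a assume a: "a \<in> \<O>"
    have "(\<lambda>x\<in>carrier G. (\<lambda>x\<in>carrier G. c * a x) x * b x) =
        (\<lambda>x\<in>carrier G. c * (\<lambda>x\<in>carrier G. a x * b x) x)"
      by (auto simp: algebra_simps)
    then show "\<chi> (\<lambda>x\<in>carrier G. (\<lambda>x\<in>carrier G. c * a x) x * b x) = c * \<chi> (\<lambda>x\<in>carrier G. a x * b x)"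
      using linear_formD(2)[OF assms regular_functions_intros(3)[OF a b]] by simp
  qed
  moreover have "linear_form \<A> (\<lambda>b. \<chi> (\<lambda>x\<in>carrier G. a x * b x))" if "a \<in> \<O>" for a
    using lin[OF that] by (simp add: mult.commute)
  ultimately show ?thesis
    by (simp add: bilinear_form_def)
qed

end

section \<open>The twisted multiplication and its center\<close>

lemma convolution_inverse_linear: "convolution_inverse B \<chi> \<chi>' \<Longrightarrow> linear_form B \<chi>'"
  by (simp add: convolution_inverse_def)

lemma convolution2_inverse_bilinear: "convolution2_inverse B J K \<Longrightarrow> bilinear_form B K"
  by (simp add: convolution2_inverse_def)

context affine_algebraic_group
begin

lemma convolution_inverse_act:
  assumes "linear_form \<A> \<chi>" "convolution_inverse \<A> \<chi> \<chi>'" "a \<in> \<O>"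
  shows "left_act \<chi> (left_act \<chi>' a) = a" "left_act \<chi>' (left_act \<chi> a) = a"
    and "right_act \<chi> (right_act \<chi>' a) = a" "right_act \<chi>' (right_act \<chi> a) = a"
proof -
  note lin = assms(1) convolution_inverse_linear[OF assms(2)]
  have inv: "convolution \<A> \<chi> \<chi>' b = b \<one>" "convolution \<A> \<chi>' \<chi> b = b \<one>" if "b \<in> \<O>" for b
    using assms(2) that by (simp_all add: convolution_inverse_def)
  show "left_act \<chi> (left_act \<chi>' a) = a"
    using left_act_convolution[OF lin(1,2) assms(3)] left_act_cong[OF assms(3) inv(1)]
      left_act_counit[OF assms(3)] by simp
  show "left_act \<chi>' (left_act \<chi> a) = a"
    using left_act_convolution[OF lin(2,1) assms(3)] left_act_cong[OF assms(3) inv(2)]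
      left_act_counit[OF assms(3)] by simp
  show "right_act \<chi> (right_act \<chi>' a) = a"
    using right_act_convolution[OF lin(2,1) assms(3)] right_act_cong[OF assms(3) inv(2)]
      right_act_counit[OF assms(3)] by simp
  show "right_act \<chi>' (right_act \<chi> a) = a"
    using right_act_convolution[OF lin(1,2) assms(3)] right_act_cong[OF assms(3) inv(1)]
      right_act_counit[OF assms(3)] by simp
qed

section \<open>The product of O(G)_J in terms of translates\<close>

lemma abelian_monoid_regular_bialgebra: "abelian_monoid \<A>"
proof (rule abelian_monoidI)
  fix a assume "a \<in> carrier \<A>"
  then show "\<zero>\<^bsub>\<A>\<^esub> \<oplus>\<^bsub>\<A>\<^esub> a = a"
    using restrict_regular_function[of a "carrier G"] by (simp cong: restrict_cong)
qed (auto simp: regular_functions_intros algebra_simps)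

lemma finsum_regular_bialgebra:
  assumes "finite I" "\<And>i. i \<in> I \<Longrightarrow> f i \<in> \<O>"
  shows "finsum \<A> f I = (\<lambda>x\<in>carrier G. \<Sum>i\<in>I. f i x)"
  using assms
proof (induction I)
  case empty
  show ?case
    by (simp add: abelian_monoid.finsum_empty[OF abelian_monoid_regular_bialgebra])
next
  case (insert i I)
  then have "finsum \<A> f (insert i I) = f i \<oplus>\<^bsub>\<A>\<^esub> finsum \<A> f I"
    by (intro abelian_monoid.finsum_insert[OF abelian_monoid_regular_bialgebra]) auto
  also have "\<dots> = (\<lambda>x\<in>carrier G. \<Sum>i\<in>insert i I. f i x)"
    using insert by auto
  finally show ?case .
qed

lemma left_translate_left_translate:
  "x \<in> carrier G \<Longrightarrow> y \<in> carrier G \<Longrightarrow> left_translate y (left_translate x a) = left_translate (x \<otimes> y) a"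
  by (auto simp: left_translate_def m_assoc)

lemma left_translate_restrict:
  "x \<in> carrier G \<Longrightarrow> left_translate x (restrict f (carrier G)) = (\<lambda>y\<in>carrier G. f (x \<otimes> y))"
  by (auto simp: left_translate_def)

lemma left_translate_one: "a \<in> \<O> \<Longrightarrow> left_translate \<one> a = a"
  using restrict_regular_function[of a "carrier G"] by (simp add: left_translate_def cong: restrict_cong)

lemma twisted_mult_sum:
  assumes "a \<in> \<O>" "b \<in> \<O>"
  shows "a \<otimes>\<^bsub>twisted_algebra \<A> J\<^esub> b = (\<lambda>x\<in>carrier G. \<Sum>p\<in>comult \<A> a \<times> comult \<A> b.
    J (snd (fst p)) (snd (snd p)) * (fst (fst p) \<otimes>\<^bsub>\<A>\<^esub> fst (snd p)) x)"
proof -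
  have reg: "fst (fst p) \<otimes>\<^bsub>\<A>\<^esub> fst (snd p) \<in> \<O>" if "p \<in> comult \<A> a \<times> comult \<A> b" for p
    using that comult_regular[OF assms(1)] comult_regular[OF assms(2)]
    by (auto intro!: regular_functions_intros(3))
  have "a \<otimes>\<^bsub>twisted_algebra \<A> J\<^esub> b = finsum \<A> (\<lambda>p. J (snd (fst p)) (snd (snd p)) \<odot>\<^bsub>\<A>\<^esub>
      (fst (fst p) \<otimes>\<^bsub>\<A>\<^esub> fst (snd p))) (comult \<A> a \<times> comult \<A> b)"
    by (simp add: twisted_algebra_def case_prod_beta)
  also have "\<dots> = (\<lambda>x\<in>carrier G. \<Sum>p\<in>comult \<A> a \<times> comult \<A> b.
      (J (snd (fst p)) (snd (snd p)) \<odot>\<^bsub>\<A>\<^esub> (fst (fst p) \<otimes>\<^bsub>\<A>\<^esub> fst (snd p))) x)"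
  proof (rule finsum_regular_bialgebra)
    fix p assume "p \<in> comult \<A> a \<times> comult \<A> b"
    from regular_functions_scale[OF reg[OF this]]
    show "J (snd (fst p)) (snd (snd p)) \<odot>\<^bsub>\<A>\<^esub> (fst (fst p) \<otimes>\<^bsub>\<A>\<^esub> fst (snd p)) \<in> \<O>"
      by simp
  qed (simp add: assms finite_comult)
  finally show ?thesis
    by (simp cong: restrict_cong)
qed

lemma twisted_mult:
  assumes "bilinear_form \<A> J" "a \<in> \<O>" "b \<in> \<O>"
  shows "a \<otimes>\<^bsub>twisted_algebra \<A> J\<^esub> b =
    (\<lambda>x\<in>carrier G. J (left_translate x a) (left_translate x b))"
  unfolding twisted_mult_sum[OF assms(2,3)]
proof (rule restrict_ext)
  fix x assume x: "x \<in> carrier G"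
  have "J (left_translate x a) (left_translate x b) =
      (\<Sum>z\<in>comult \<A> a. \<Sum>w\<in>comult \<A> b. fst z x * fst w x * J (snd z) (snd w))"
    unfolding left_translate_sum[OF coproduct_sum_comult[OF assms(2)] x]
      left_translate_sum[OF coproduct_sum_comult[OF assms(3)] x]
    using comult_regular[OF assms(2)] comult_regular[OF assms(3)] by (intro bilinear_form_sum[OF assms(1)]) auto
  then show "(\<Sum>p\<in>comult \<A> a \<times> comult \<A> b.
      J (snd (fst p)) (snd (snd p)) * (fst (fst p) \<otimes>\<^bsub>\<A>\<^esub> fst (snd p)) x) =
    J (left_translate x a) (left_translate x b)"
    using x by (simp add: sum.cartesian_product case_prod_beta mult_ac)
qed

lemma twisted_mult_closed:
  assumes "a \<in> \<O>" "b \<in> \<O>"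
  shows "a \<otimes>\<^bsub>twisted_algebra \<A> J\<^esub> b \<in> \<O>"
  unfolding twisted_mult_sum[OF assms]
proof (rule regular_functions_sum)
  fix p assume "p \<in> comult \<A> a \<times> comult \<A> b"
  then show "fst (fst p) \<otimes>\<^bsub>\<A>\<^esub> fst (snd p) \<in> \<O>"
    using comult_regular[OF assms(1)] comult_regular[OF assms(2)]
    by (auto intro!: regular_functions_intros(3))
qed

text \<open>The twist uses only the right legs of the coproducts, so left translations respect the
  product of O(G)_J. Identities between products may thus be checked at the unit of G, for all
  translates of the factors.\<close>

lemma left_translate_twisted_mult:
  assumes "bilinear_form \<A> J" "a \<in> \<O>" "b \<in> \<O>" "x \<in> carrier G"
  shows "left_translate x (a \<otimes>\<^bsub>twisted_algebra \<A> J\<^esub> b) =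
    left_translate x a \<otimes>\<^bsub>twisted_algebra \<A> J\<^esub> left_translate x b"
  using assms
  by (simp add: twisted_mult left_translate_closed left_translate_left_translate left_translate_restrict
      cong: restrict_cong)

lemma form_twisted_mult:
  assumes "linear_form \<A> \<chi>" "a \<in> \<O>" "b \<in> \<O>"
  shows "\<chi> (a \<otimes>\<^bsub>twisted_algebra \<A> J\<^esub> b) = convolution2 \<A> (\<lambda>a b. \<chi> (a \<otimes>\<^bsub>\<A>\<^esub> b)) J a b"
proof -
  have "\<chi> (a \<otimes>\<^bsub>twisted_algebra \<A> J\<^esub> b) = (\<Sum>p\<in>comult \<A> a \<times> comult \<A> b.
    J (snd (fst p)) (snd (snd p)) * \<chi> (fst (fst p) \<otimes>\<^bsub>\<A>\<^esub> fst (snd p)))"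
    unfolding twisted_mult_sum[OF assms(2,3)]
  proof (rule linear_form_sum[OF assms(1)])
    fix p assume "p \<in> comult \<A> a \<times> comult \<A> b"
    then show "fst (fst p) \<otimes>\<^bsub>\<A>\<^esub> fst (snd p) \<in> \<O>"
      using comult_regular[OF assms(2)] comult_regular[OF assms(3)]
      by (auto intro!: regular_functions_intros(3))
  qed
  then show ?thesis
    by (simp add: convolution2_def sum.cartesian_product case_prod_beta mult.commute)
qed

lemma left_act_twisted_mult:
  assumes \<chi>: "linear_form \<A> \<chi>" "convolution_inverse \<A> \<chi> \<chi>'"
    and J: "bilinear_form \<A> J" "bilinear_form \<A> J'"
    and gauge: "\<And>a b. a \<in> \<O> \<Longrightarrow> b \<in> \<O> \<Longrightarrow> J' a b =
      convolution2 \<A> (convolution2 \<A> (\<lambda>x y. \<chi> (x \<otimes>\<^bsub>\<A>\<^esub> y)) J) (\<lambda>x y. \<chi>' x * \<chi>' y) a b"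
    and ab: "a \<in> \<O>" "b \<in> \<O>"
  shows "left_act \<chi> (a \<otimes>\<^bsub>twisted_algebra \<A> J\<^esub> b) =
    left_act \<chi> a \<otimes>\<^bsub>twisted_algebra \<A> J'\<^esub> left_act \<chi> b"
proof -
  note \<chi>' = convolution_inverse_linear[OF \<chi>(2)]
  \<comment> \<open>This is the claim at the unit of G. The factors \<open>\<chi>'\<close> of the
    gauge formula undo \<open>left_act \<chi>\<close>, and what remains is
    \<open>(\<chi> \<circ> m) * J\<close>, which computes \<chi> of a twisted product.\<close>
  have key: "\<chi> (u \<otimes>\<^bsub>twisted_algebra \<A> J\<^esub> v) = J' (left_act \<chi> u) (left_act \<chi> v)"
    if "u \<in> \<O>" "v \<in> \<O>" for u v
  proof -
    have "J' (left_act \<chi> u) (left_act \<chi> v) = convolution2 \<A> (\<lambda>x y. \<chi> (x \<otimes>\<^bsub>\<A>\<^esub> y)) J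
        (left_act \<chi>' (left_act \<chi> u)) (left_act \<chi>' (left_act \<chi> v))"
      using that
      by (simp only: gauge left_act_closed[OF \<chi>(1)]
          convolution2_product_right[OF bilinear_form_convolution2[OF bilinear_form_mult[OF \<chi>(1)] J(1)] \<chi>' \<chi>'])
    then show ?thesis
      by (simp only: convolution_inverse_act[OF \<chi>] that form_twisted_mult[OF \<chi>(1)])
  qed
  show ?thesis
    unfolding left_act_def[of \<chi> "_ \<otimes>\<^bsub>_\<^esub> _"]
      twisted_mult[OF J(2) left_act_closed[OF \<chi>(1) ab(1)] left_act_closed[OF \<chi>(1) ab(2)]]
  proof (rule restrict_ext)
    fix x assume x: "x \<in> carrier G"
    show "\<chi> (left_translate x (a \<otimes>\<^bsub>twisted_algebra \<A> J\<^esub> b)) =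
      J' (left_translate x (left_act \<chi> a)) (left_translate x (left_act \<chi> b))"
      using x ab by (simp only: left_translate_twisted_mult[OF J(1)] key left_translate_closed
          left_act_left_translate)
  qed
qed

text \<open>In R = J_21^-1 * J the factor J meets a only through left translates of a. There J
  agrees with its flip, so R(b, a) equals the value of J_21^-1 * J_21, which is the unit of
  convolution.\<close>

lemma R_form_symmetric:
  assumes J: "hopf_2cocycle \<A> J" and ab: "a \<in> \<O>" "b \<in> \<O>"
    and sym: "\<And>x c. x \<in> carrier G \<Longrightarrow> c \<in> \<O> \<Longrightarrow> J (left_translate x a) c = J c (left_translate x a)"
  shows "R_form \<A> J b a = b \<one> * a \<one>"
proof -
  define L where "L = (SOME K. convolution2_inverse \<A> (\<lambda>a b. J b a) K)"
  have L: "convolution2_inverse \<A> (\<lambda>a b. J b a) L"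
    unfolding L_def by (rule hopf_2cocycle_flip_inverse[OF J])
  then have linL: "linear_form \<A> (L u)" if "u \<in> \<O>" for u
    using that bilinear_formD(1)[of \<A> L u] by (simp add: convolution2_inverse_def)
  have linJ: "linear_form \<A> (J u)" "linear_form \<A> (\<lambda>v. J v u)" if "u \<in> \<O>" for u
    using J that bilinear_formD[of \<A> J u] by (simp_all add: hopf_2cocycle_def)
  have "left_act (J v) a = left_act (\<lambda>u. J u v) a" if "v \<in> \<O>" for v
    unfolding left_act_def by (rule restrict_ext) (simp add: sym that)
  then have "convolution \<A> (L u) (J v) a = convolution \<A> (L u) (\<lambda>u. J u v) a"
    if "u \<in> \<O>" "v \<in> \<O>" for u v
    using that by (simp add: convolution_left_act[OF linL linJ(1) ab(1)]
        convolution_left_act[OF linL linJ(2) ab(1)])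
  then have "R_form \<A> J b a = convolution2 \<A> L (\<lambda>a b. J b a) b a"
    unfolding R_form_def L_def[symmetric] convolution2_convolution(2)
    using comult_regular[OF ab(2)] by (intro sum.cong refl) auto
  also have "\<dots> = b \<one> * a \<one>"
    using L ab by (simp add: convolution2_inverse_def)
  finally show ?thesis .
qed

text \<open>The constant 1 has the same symmetry as a. By \<open>R_form_symmetric\<close> the
  function a minus its value at the unit of G then pairs to zero with every b, and minimality makes
  it zero.\<close>

lemma minimal_symmetric_constant:
  assumes J: "hopf_2cocycle \<A> J" and minimal: "minimal_form \<A> J" and a: "a \<in> \<O>"
    and sym: "\<And>x c. x \<in> carrier G \<Longrightarrow> c \<in> \<O> \<Longrightarrow> J (left_translate x a) c = J c (left_translate x a)"
    and x: "x \<in> carrier G"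
  shows "a x = a \<one>"
proof -
  let ?e = "\<lambda>x\<in>carrier G. 1 :: complex"
  have e: "?e \<in> \<O>"
    by (rule regular_functions_intros)
  have "left_translate x ?e = ?e" if "x \<in> carrier G" for x
    using that by (auto simp: left_translate_def)
  then have "J (left_translate x ?e) c = J c (left_translate x ?e)" if "x \<in> carrier G" "c \<in> \<O>" for x c
    using that J by (simp add: hopf_2cocycle_def)
  then have Re: "R_form \<A> J b ?e = b \<one>" if "b \<in> \<O>" for b
    using R_form_symmetric[OF J e that] by simp
  have Ra: "R_form \<A> J b a = b \<one> * a \<one>" if "b \<in> \<O>" for b
    using R_form_symmetric[OF J a that sym] by simp
  define ce where "ce = (\<lambda>x\<in>carrier G. - a \<one> * ?e x)"
  have ce: "ce \<in> \<O>"
    unfolding ce_def by (rule regular_functions_scale[OF e])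
  define d where "d = (\<lambda>x\<in>carrier G. a x + ce x)"
  have "bilinear_form \<A> (R_form \<A> J)"
    unfolding R_form_def
  proof (rule bilinear_form_convolution2)
    show "bilinear_form \<A> (SOME K. convolution2_inverse \<A> (\<lambda>a b. J b a) K)"
      by (rule convolution2_inverse_bilinear[OF hopf_2cocycle_flip_inverse[OF J]])
    show "bilinear_form \<A> J"
      using J by (simp add: hopf_2cocycle_def)
  qed
  then have lin: "linear_form \<A> (R_form \<A> J b)" if "b \<in> \<O>" for b
    using that bilinear_formD(1)[of \<A> "R_form \<A> J" b] by simp
  have "R_form \<A> J b d = 0" if "b \<in> \<O>" for b
  proof -
    have "R_form \<A> J b d = R_form \<A> J b a + R_form \<A> J b ce"
      unfolding d_def by (rule linear_formD(1)[OF lin[OF that] a ce])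
    also have "R_form \<A> J b ce = - a \<one> * R_form \<A> J b ?e"
      unfolding ce_def by (rule linear_formD(2)[OF lin[OF that] e])
    finally show ?thesis
      by (simp add: Ra Re that)
  qed
  moreover have "d \<in> \<O>"
    unfolding d_def by (rule regular_functions_intros(2)[OF a ce])
  ultimately have "d = (\<lambda>x\<in>carrier G. 0)"
    using minimal unfolding minimal_form_def by auto
  from fun_cong[OF this, of x] x show ?thesis
    by (simp add: d_def ce_def)
qed

section \<open>The center for a cocycle pulled back from a closed subgroup\<close>

lemma carrier_center: "carrier (algebra_center (twisted_algebra \<A> J)) =
    {z \<in> \<O>. \<forall>b\<in>\<O>. z \<otimes>\<^bsub>twisted_algebra \<A> J\<^esub> b = b \<otimes>\<^bsub>twisted_algebra \<A> J\<^esub> z}"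
  by (simp add: algebra_center_def) (simp add: twisted_algebra_def)

definition right_invariants :: "point set \<Rightarrow> (point \<Rightarrow> complex) set" where
  "right_invariants H = {f \<in> \<O>. \<forall>g\<in>carrier G. \<forall>h\<in>H. f (g \<otimes> h) = f g}"

context
  fixes H J K
  assumes H: "closed_subgroup n G H"
    and K: "hopf_2cocycle (regular_bialgebra (G\<lparr>carrier := H\<rparr>)) K"
    and J: "bilinear_form \<A> J" "\<And>a b. a \<in> \<O> \<Longrightarrow> b \<in> \<O> \<Longrightarrow> J a b = K (restrict a H) (restrict b H)"
begin

lemma subgroup_subset: "h \<in> H \<Longrightarrow> h \<in> carrier G" and subgroup_one: "\<one> \<in> H"
  using H subgroup.mem_carrier subgroup.one_closed by (auto simp: closed_subgroup_def)

lemma restrict_regular: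
  assumes "a \<in> \<O>"
  shows "restrict a H \<in> regular_functions H"
proof -
  obtain p where p: "p \<in> poly_functions" "a = restrict p (carrier G)"
    using assms by (auto simp: regular_functions_def)
  then have "restrict a H = restrict p H"
    using subgroup_subset by auto
  then show ?thesis
    using p(1) by (simp add: regular_functions_def)
qed

text \<open>Regular functions on G and on H both come from polynomials on the ambient space.
  Surjectivity lets a symmetry known on G be tested against every regular function on H.\<close>

lemma restrict_regular_surj:
  assumes "c \<in> regular_functions H"
  obtains a where "a \<in> \<O>" "c = restrict a H"
proof -
  obtain p where p: "p \<in> poly_functions" "c = restrict p H"
    using assms by (auto simp: regular_functions_def)
  have "restrict p (carrier G) \<in> \<O>"
    using p(1) by (simp add: regular_functions_def)
  moreover have "c = restrict (restrict p (carrier G)) H"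
    using p(2) subgroup_subset by auto
  ultimately show ?thesis
    using that by blast
qed

lemma twisted_mult_right_invariants:
  assumes z: "z \<in> right_invariants H" and b: "b \<in> \<O>"
  shows "z \<otimes>\<^bsub>twisted_algebra \<A> J\<^esub> b = (\<lambda>x\<in>carrier G. z x * b x)"
    and "b \<otimes>\<^bsub>twisted_algebra \<A> J\<^esub> z = (\<lambda>x\<in>carrier G. z x * b x)"
proof -
  interpret H: affine_algebraic_group n "G\<lparr>carrier := H\<rparr>"
    by (rule closed_subgroup_algebraic[OF affine_algebraic_group_axioms H])
  have z': "z \<in> \<O>"
    using z by (simp add: right_invariants_def)
  let ?e = "\<lambda>h\<in>H. 1 :: complex"
  have "J (left_translate x z) (left_translate x b) = z x * b x \<and>
      J (left_translate x b) (left_translate x z) = z x * b x" if x: "x \<in> carrier G" for x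
  proof -
    define c where "c = restrict (left_translate x b) H"
    have c: "c \<in> regular_functions H"
      unfolding c_def by (rule restrict_regular[OF left_translate_closed[OF b x]])
    have e: "?e \<in> regular_functions H"
      by (rule regular_functions_intros)
    \<comment> \<open>Invariance makes the translate of z constant on H, so K always has a constant
      as one argument and its normalisation decides the value.\<close>
    have "restrict (left_translate x z) H = (\<lambda>h\<in>H. z x * ?e h)"
      using z x subgroup_subset by (auto simp: right_invariants_def left_translate_def)
    moreover have "linear_form (regular_bialgebra (G\<lparr>carrier := H\<rparr>)) (K c)"
      "linear_form (regular_bialgebra (G\<lparr>carrier := H\<rparr>)) (\<lambda>u. K u c)"
      using K c bilinear_formD[of "regular_bialgebra (G\<lparr>carrier := H\<rparr>)" K c] by (simp_all add: hopf_2cocycle_def)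
    from H.linear_formD(2)[OF this(1), of ?e "z x"] H.linear_formD(2)[OF this(2), of ?e "z x"] e
    have "K c (\<lambda>h\<in>H. z x * ?e h) = z x * K c ?e" "K (\<lambda>h\<in>H. z x * ?e h) c = z x * K ?e c"
      by simp_all
    moreover have "K c ?e = c \<one>" "K ?e c = c \<one>"
      using K c by (simp_all add: hopf_2cocycle_def)
    moreover have "c \<one> = b x"
      using x subgroup_one by (simp add: c_def left_translate_def)
    ultimately show ?thesis
      using J(2)[OF left_translate_closed[OF z' x] left_translate_closed[OF b x]]
        J(2)[OF left_translate_closed[OF b x] left_translate_closed[OF z' x]]
      by (simp add: c_def)
  qed
  then show "z \<otimes>\<^bsub>twisted_algebra \<A> J\<^esub> b = (\<lambda>x\<in>carrier G. z x * b x)"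
    "b \<otimes>\<^bsub>twisted_algebra \<A> J\<^esub> z = (\<lambda>x\<in>carrier G. z x * b x)"
    by (auto simp: twisted_mult[OF J(1)] z' b)
qed

lemma central_right_invariant:
  assumes minimal: "minimal_form (regular_bialgebra (G\<lparr>carrier := H\<rparr>)) K"
    and z: "z \<in> \<O>"
    and central: "\<And>b. b \<in> \<O> \<Longrightarrow> z \<otimes>\<^bsub>twisted_algebra \<A> J\<^esub> b = b \<otimes>\<^bsub>twisted_algebra \<A> J\<^esub> z"
  shows "z \<in> right_invariants H"
proof -
  interpret H: affine_algebraic_group n "G\<lparr>carrier := H\<rparr>"
    by (rule closed_subgroup_algebraic[OF affine_algebraic_group_axioms H])
  have comm: "J (left_translate g z) c = J c (left_translate g z)" if g: "g \<in> carrier G" and c: "c \<in> \<O>" for g c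
  proof -
    \<comment> \<open>The value at g of a product is J on the translates by g. Translating c back by
      g first makes the second of these an arbitrary c.\<close>
    define b where "b = left_translate (inv g) c"
    have b: "b \<in> \<O>"
      unfolding b_def using c g by (intro left_translate_closed) auto
    have "left_translate g b = c"
      unfolding b_def using g c by (simp add: left_translate_left_translate left_translate_one)
    moreover have "J (left_translate g z) (left_translate g b) = J (left_translate g b) (left_translate g z)"
      using fun_cong[OF central[OF b], of g] g by (simp add: twisted_mult[OF J(1)] z b)
    ultimately show ?thesis
      by simp
  qed
  have "z (x \<otimes> h) = z x" if x: "x \<in> carrier G" and h: "h \<in> H" for x h
  proof -
    define u where "u = restrict (left_translate x z) H"
    have u: "u \<in> regular_functions H"
      unfolding u_def by (rule restrict_regular[OF left_translate_closed[OF z x]])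
    \<comment> \<open>Translating u by k inside H amounts to translating z by xk in G, so
      \<open>comm\<close> covers all translates that \<open>minimal_symmetric_constant\<close> asks
      for.\<close>
    have "K (H.left_translate k u) c = K c (H.left_translate k u)"
      if k: "k \<in> H" and c: "c \<in> regular_functions H" for k c
    proof -
      obtain a where a: "a \<in> \<O>" "c = restrict a H"
        using restrict_regular_surj[OF c] .
      have kG: "k \<in> carrier G" and xk: "x \<otimes> k \<in> carrier G"
        using x k subgroup_subset by auto
      have "k \<otimes> y \<in> H" if "y \<in> H" for y
        using H k that subgroup.m_closed by (auto simp: closed_subgroup_def)
      then have "H.left_translate k u = restrict (left_translate (x \<otimes> k) z) H"
        using x kG subgroup_subset by (auto simp: H.left_translate_def left_translate_def u_def m_assoc)
      then show ?thesis
        using comm[OF xk a(1)] by (simp add: a J(2) left_translate_closed[OF z xk])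
    qed
    then have "u h = u \<one>"
      using H.minimal_symmetric_constant[OF K minimal, of u h] u h by simp
    then show ?thesis
      using h x subgroup_one subgroup_subset by (simp add: u_def left_translate_def)
  qed
  then show ?thesis
    using z by (simp add: right_invariants_def)
qed

lemma carrier_center_twisted:
  assumes "minimal_form (regular_bialgebra (G\<lparr>carrier := H\<rparr>)) K"
  shows "carrier (algebra_center (twisted_algebra \<A> J)) = right_invariants H"
proof -
  have "carrier (algebra_center (twisted_algebra \<A> J)) =
    {z \<in> \<O>. \<forall>b\<in>\<O>. z \<otimes>\<^bsub>twisted_algebra \<A> J\<^esub> b = b \<otimes>\<^bsub>twisted_algebra \<A> J\<^esub> z}"
    by (rule carrier_center)
  also have "\<dots> = right_invariants H"
  proof (intro subset_antisym subsetI)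
    fix z assume z: "z \<in> right_invariants H"
    then have "z \<in> \<O>"
      by (simp add: right_invariants_def)
    then show "z \<in> {z \<in> \<O>. \<forall>b\<in>\<O>. z \<otimes>\<^bsub>twisted_algebra \<A> J\<^esub> b = b \<otimes>\<^bsub>twisted_algebra \<A> J\<^esub> z}"
      using twisted_mult_right_invariants[OF z] by simp
  next
    fix z assume "z \<in> {z \<in> \<O>. \<forall>b\<in>\<O>. z \<otimes>\<^bsub>twisted_algebra \<A> J\<^esub> b = b \<otimes>\<^bsub>twisted_algebra \<A> J\<^esub> z}"
    then show "z \<in> right_invariants H"
      by (intro central_right_invariant[OF assms]) blast+
  qed
  finally show ?thesis .
qed

end

end

section \<open>Gauge invariance of minimality\<close>

text \<open>Read P as \<open>\<chi> \<circ> m\<close>, Q as \<open>\<chi> \<otimes> \<chi>\<close>,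
  P' and Q' as their inverses, T as the flipped J and L as the inverse of T. The left inverse L' of
  P T Q' must equal its right inverse Q L P', whose last factor then cancels P.\<close>

lemma (in monoid) conjugate_inverse_mult:
  assumes closed: "P \<in> carrier G" "P' \<in> carrier G" "Q \<in> carrier G" "Q' \<in> carrier G"
    "J \<in> carrier G" "T \<in> carrier G" "L \<in> carrier G" "L' \<in> carrier G"
    and inv: "P \<otimes> P' = \<one>" "P' \<otimes> P = \<one>" "Q' \<otimes> Q = \<one>" "T \<otimes> L = \<one>"
    and L': "L' \<otimes> (P \<otimes> T \<otimes> Q') = \<one>"
  shows "L' \<otimes> (P \<otimes> J \<otimes> Q') = Q \<otimes> (L \<otimes> J) \<otimes> Q'"
proof -
  have "(P \<otimes> T \<otimes> Q') \<otimes> (Q \<otimes> L \<otimes> P') = P \<otimes> T \<otimes> (Q' \<otimes> Q) \<otimes> L \<otimes> P'"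
    using closed by (simp add: m_assoc)
  also have "\<dots> = P \<otimes> (T \<otimes> L) \<otimes> P'"
    using closed by (simp add: inv(3) m_assoc)
  also have "\<dots> = \<one>"
    using closed by (simp add: inv)
  finally have "L' = L' \<otimes> ((P \<otimes> T \<otimes> Q') \<otimes> (Q \<otimes> L \<otimes> P'))"
    using closed by simp
  also have "\<dots> = (L' \<otimes> (P \<otimes> T \<otimes> Q')) \<otimes> (Q \<otimes> L \<otimes> P')"
    using closed by (simp add: m_assoc)
  also have "\<dots> = Q \<otimes> L \<otimes> P'"
    using closed by (simp add: L')
  finally have "L' \<otimes> (P \<otimes> J \<otimes> Q') = Q \<otimes> L \<otimes> (P' \<otimes> P) \<otimes> J \<otimes> Q'"
    using closed by (simp add: m_assoc)
  then show ?thesis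
    using closed by (simp add: inv(2) m_assoc)
qed

context affine_algebraic_group
begin

text \<open>
  Forms matter only on \<open>\<O>\<close>. Cutting them off outside makes agreement on \<open>\<O>\<close> an equality of
  functions, so that convolution of forms becomes a monoid operation.
\<close>

definition cut_form :: "(point \<Rightarrow> complex) form \<Rightarrow> (point \<Rightarrow> complex) form" where
  "cut_form J = (\<lambda>a b. if a \<in> \<O> \<and> b \<in> \<O> then J a b else 0)"

definition form_monoid :: "(point \<Rightarrow> complex) form monoid" where
  "form_monoid = \<lparr>carrier = cut_form ` {J. bilinear_form \<A> J},
    monoid.mult = (\<lambda>J K. cut_form (convolution2 \<A> J K)), one = cut_form (\<lambda>a b. a \<one> * b \<one>)\<rparr>"

lemma cut_form_apply: "a \<in> \<O> \<Longrightarrow> b \<in> \<O> \<Longrightarrow> cut_form J a b = J a b"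
  by (simp add: cut_form_def)

lemma cut_form_eqI: "(\<And>a b. a \<in> \<O> \<Longrightarrow> b \<in> \<O> \<Longrightarrow> J a b = K a b) \<Longrightarrow> cut_form J = cut_form K"
  by (intro ext) (simp add: cut_form_def)

lemma cut_form_eqD: "cut_form J = cut_form K \<Longrightarrow> a \<in> \<O> \<Longrightarrow> b \<in> \<O> \<Longrightarrow> J a b = K a b"
  using cut_form_apply[of a b J] cut_form_apply[of a b K] by simp

lemma carrier_form_monoid: "bilinear_form \<A> J \<Longrightarrow> cut_form J \<in> carrier form_monoid"
  by (simp add: form_monoid_def)

lemma mult_form_monoid:
  "cut_form J \<otimes>\<^bsub>form_monoid\<^esub> cut_form K = cut_form (convolution2 \<A> J K)"
proof -
  have "cut_form (convolution2 \<A> (cut_form J) (cut_form K)) = cut_form (convolution2 \<A> J K)"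
    by (intro cut_form_eqI convolution2_cong) (simp_all add: cut_form_apply)
  then show ?thesis
    by (simp add: form_monoid_def)
qed

lemma one_form_monoid: "\<one>\<^bsub>form_monoid\<^esub> = cut_form (\<lambda>a b. a \<one> * b \<one>)"
  by (simp add: form_monoid_def)

text \<open>The unit is the product form built from the counit, so the unit laws are the
  substitution rules for product forms combined with the trivial action of the counit.\<close>

lemma monoid_form_monoid: "monoid form_monoid"
proof (rule monoidI)
  fix x y z assume "x \<in> carrier form_monoid" "y \<in> carrier form_monoid" "z \<in> carrier form_monoid"
  then obtain J K L where x: "x = cut_form J" "bilinear_form \<A> J"
    and y: "y = cut_form K" "bilinear_form \<A> K"
    and z: "z = cut_form L" "bilinear_form \<A> L"
    by (auto simp: form_monoid_def)
  show "x \<otimes>\<^bsub>form_monoid\<^esub> y \<in> carrier form_monoid"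
    using x y by (simp add: mult_form_monoid carrier_form_monoid bilinear_form_convolution2)
  show "(x \<otimes>\<^bsub>form_monoid\<^esub> y) \<otimes>\<^bsub>form_monoid\<^esub> z = x \<otimes>\<^bsub>form_monoid\<^esub> (y \<otimes>\<^bsub>form_monoid\<^esub> z)"
    unfolding x(1) y(1) z(1) mult_form_monoid
    by (rule cut_form_eqI) (rule convolution2_assoc[OF x(2) y(2) z(2)])
  show "\<one>\<^bsub>form_monoid\<^esub> \<otimes>\<^bsub>form_monoid\<^esub> x = x"
    unfolding x(1) one_form_monoid mult_form_monoid
    using convolution2_product_left[OF x(2) linear_form_eval[OF one_closed] linear_form_eval[OF one_closed]]
    by (intro cut_form_eqI) (simp add: right_act_counit)
  show "x \<otimes>\<^bsub>form_monoid\<^esub> \<one>\<^bsub>form_monoid\<^esub> = x"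
    unfolding x(1) one_form_monoid mult_form_monoid
    using convolution2_product_right[OF x(2) linear_form_eval[OF one_closed] linear_form_eval[OF one_closed]]
    by (intro cut_form_eqI) (simp add: left_act_counit)
next
  show "\<one>\<^bsub>form_monoid\<^esub> \<in> carrier form_monoid"
    unfolding one_form_monoid
    by (rule carrier_form_monoid) (rule bilinear_form_product[OF linear_form_eval[OF one_closed] linear_form_eval[OF one_closed]])
qed

lemma convolution2_inverse_form_monoid:
  assumes "convolution2_inverse \<A> J K"
  shows "cut_form J \<otimes>\<^bsub>form_monoid\<^esub> cut_form K = \<one>\<^bsub>form_monoid\<^esub>"
    and "cut_form K \<otimes>\<^bsub>form_monoid\<^esub> cut_form J = \<one>\<^bsub>form_monoid\<^esub>"
  unfolding one_form_monoid mult_form_monoid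
  using assms by (auto intro!: cut_form_eqI simp: convolution2_inverse_def)

lemma product_inverse_form_monoid:
  assumes "linear_form \<A> \<chi>" "linear_form \<A> \<chi>'"
    and "\<And>a. a \<in> \<O> \<Longrightarrow> convolution \<A> \<chi> \<chi>' a = a \<one>"
  shows "cut_form (\<lambda>a b. \<chi> a * \<chi> b) \<otimes>\<^bsub>form_monoid\<^esub> cut_form (\<lambda>a b. \<chi>' a * \<chi>' b) = \<one>\<^bsub>form_monoid\<^esub>"
  unfolding one_form_monoid mult_form_monoid
proof (rule cut_form_eqI)
  fix a b assume "a \<in> \<O>" "b \<in> \<O>"
  then show "convolution2 \<A> (\<lambda>a b. \<chi> a * \<chi> b) (\<lambda>a b. \<chi>' a * \<chi>' b) a b = a \<one> * b \<one>"
    using convolution2_product_right[OF bilinear_form_product[OF assms(1,1)] assms(2,2), of a b]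
      convolution_left_act[OF assms(1,2), of a] convolution_left_act[OF assms(1,2), of b] assms(3)
    by simp
qed

lemma mult_inverse_form_monoid:
  assumes "linear_form \<A> \<chi>" "linear_form \<A> \<chi>'"
    and "\<And>a. a \<in> \<O> \<Longrightarrow> convolution \<A> \<chi> \<chi>' a = a \<one>"
  shows "cut_form (\<lambda>a b. \<chi> (a \<otimes>\<^bsub>\<A>\<^esub> b)) \<otimes>\<^bsub>form_monoid\<^esub> cut_form (\<lambda>a b. \<chi>' (a \<otimes>\<^bsub>\<A>\<^esub> b)) =
    \<one>\<^bsub>form_monoid\<^esub>"
  unfolding one_form_monoid mult_form_monoid
proof (rule cut_form_eqI)
  fix a b assume ab: "a \<in> \<O>" "b \<in> \<O>"
  show "convolution2 \<A> (\<lambda>a b. \<chi> (a \<otimes>\<^bsub>\<A>\<^esub> b)) (\<lambda>a b. \<chi>' (a \<otimes>\<^bsub>\<A>\<^esub> b)) a b = a \<one> * b \<one>"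
    unfolding convolution2_mult[OF assms(1,2) ab]
    using assms(3)[OF regular_functions_intros(3)[OF ab]] by simp
qed

text \<open>The gauge formula for the flipped J' is the one for J' with J flipped, which determines
  the inverse of the flipped J'. R^J' comes out as R^J conjugated by a product form, and the two
  substitution rules yield the arguments on the right.\<close>

lemma R_form_gauge:
  assumes \<chi>: "linear_form \<A> \<chi>" "convolution_inverse \<A> \<chi> \<chi>'"
    and J: "hopf_2cocycle \<A> J" "hopf_2cocycle \<A> J'"
    and gauge: "\<And>a b. a \<in> \<O> \<Longrightarrow> b \<in> \<O> \<Longrightarrow> J' a b =
      convolution2 \<A> (convolution2 \<A> (\<lambda>x y. \<chi> (x \<otimes>\<^bsub>\<A>\<^esub> y)) J) (\<lambda>x y. \<chi>' x * \<chi>' y) a b"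
    and ab: "a \<in> \<O>" "b \<in> \<O>"
  shows "R_form \<A> J' a b = R_form \<A> J (right_act \<chi> (left_act \<chi>' a)) (right_act \<chi> (left_act \<chi>' b))"
proof -
  interpret M: monoid form_monoid
    by (rule monoid_form_monoid)
  note \<chi>' = convolution_inverse_linear[OF \<chi>(2)]
  have inv: "convolution \<A> \<chi> \<chi>' a = a \<one>" "convolution \<A> \<chi>' \<chi> a = a \<one>" if "a \<in> \<O>" for a
    using \<chi>(2) that by (simp_all add: convolution_inverse_def)
  have bil: "bilinear_form \<A> J" "bilinear_form \<A> J'"
    using J by (simp_all add: hopf_2cocycle_def)
  define L where "L = (SOME K. convolution2_inverse \<A> (\<lambda>a b. J b a) K)"
  have L: "convolution2_inverse \<A> (\<lambda>a b. J b a) L"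
    unfolding L_def by (rule hopf_2cocycle_flip_inverse[OF J(1)])
  define L' where "L' = (SOME K. convolution2_inverse \<A> (\<lambda>a b. J' b a) K)"
  have L': "convolution2_inverse \<A> (\<lambda>a b. J' b a) L'"
    unfolding L'_def by (rule hopf_2cocycle_flip_inverse[OF J(2)])
  let ?P = "cut_form (\<lambda>a b. \<chi> (a \<otimes>\<^bsub>\<A>\<^esub> b))" and ?P' = "cut_form (\<lambda>a b. \<chi>' (a \<otimes>\<^bsub>\<A>\<^esub> b))"
  let ?Q = "cut_form (\<lambda>a b. \<chi> a * \<chi> b)" and ?Q' = "cut_form (\<lambda>a b. \<chi>' a * \<chi>' b)"
  have J': "cut_form J' = ?P \<otimes>\<^bsub>form_monoid\<^esub> cut_form J \<otimes>\<^bsub>form_monoid\<^esub> ?Q'"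
    unfolding mult_form_monoid by (rule cut_form_eqI) (rule gauge)
  have J'_flip: "cut_form (\<lambda>a b. J' b a) = ?P \<otimes>\<^bsub>form_monoid\<^esub> cut_form (\<lambda>a b. J b a) \<otimes>\<^bsub>form_monoid\<^esub> ?Q'"
    unfolding mult_form_monoid
  proof (rule cut_form_eqI)
    fix a b assume ab: "a \<in> \<O>" "b \<in> \<O>"
    \<comment> \<open>O(G) is commutative, so \<open>\<chi> \<circ> m\<close> is its own
      flip.\<close>
    have P: "convolution2 \<A> (\<lambda>a b. \<chi> (a \<otimes>\<^bsub>\<A>\<^esub> b)) (\<lambda>a b. J b a) =
        (\<lambda>u v. convolution2 \<A> (\<lambda>a b. \<chi> (a \<otimes>\<^bsub>\<A>\<^esub> b)) J v u)"
      using convolution2_flip[of \<A> "\<lambda>a b. \<chi> (a \<otimes>\<^bsub>\<A>\<^esub> b)" J] by (intro ext) (simp add: mult.commute)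
    have "J' b a = convolution2 \<A> (\<lambda>u v. convolution2 \<A> (\<lambda>x y. \<chi> (x \<otimes>\<^bsub>\<A>\<^esub> y)) J v u)
        (\<lambda>x y. \<chi>' y * \<chi>' x) a b"
      unfolding gauge[OF ab(2,1)] by (rule convolution2_flip[symmetric])
    moreover have "(\<lambda>x y. \<chi>' y * \<chi>' x) = (\<lambda>a b. \<chi>' a * \<chi>' b)"
      by (simp add: mult.commute)
    ultimately show "J' b a = convolution2 \<A> (convolution2 \<A> (\<lambda>a b. \<chi> (a \<otimes>\<^bsub>\<A>\<^esub> b)) (\<lambda>a b. J b a))
        (\<lambda>a b. \<chi>' a * \<chi>' b) a b"
      by (simp only: P)
  qed
  have "cut_form L' \<otimes>\<^bsub>form_monoid\<^esub> (?P \<otimes>\<^bsub>form_monoid\<^esub> cut_form J \<otimes>\<^bsub>form_monoid\<^esub> ?Q') =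
    ?Q \<otimes>\<^bsub>form_monoid\<^esub> (cut_form L \<otimes>\<^bsub>form_monoid\<^esub> cut_form J) \<otimes>\<^bsub>form_monoid\<^esub> ?Q'"
  proof (rule M.conjugate_inverse_mult)
    show "?P \<in> carrier form_monoid" "?P' \<in> carrier form_monoid"
      by (rule carrier_form_monoid[OF bilinear_form_mult[OF \<chi>(1)]])
        (rule carrier_form_monoid[OF bilinear_form_mult[OF \<chi>']])
    show "?Q \<in> carrier form_monoid" "?Q' \<in> carrier form_monoid"
      by (rule carrier_form_monoid[OF bilinear_form_product[OF \<chi>(1,1)]])
        (rule carrier_form_monoid[OF bilinear_form_product[OF \<chi>' \<chi>']])
    show "cut_form J \<in> carrier form_monoid" "cut_form (\<lambda>a b. J b a) \<in> carrier form_monoid"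
      by (rule carrier_form_monoid[OF bil(1)]) (rule carrier_form_monoid[OF bilinear_form_flip[OF bil(1)]])
    show "cut_form L \<in> carrier form_monoid" "cut_form L' \<in> carrier form_monoid"
      by (rule carrier_form_monoid[OF convolution2_inverse_bilinear[OF L]])
        (rule carrier_form_monoid[OF convolution2_inverse_bilinear[OF L']])
    show "?P \<otimes>\<^bsub>form_monoid\<^esub> ?P' = \<one>\<^bsub>form_monoid\<^esub>"
      by (rule mult_inverse_form_monoid[OF \<chi>(1) \<chi>' inv(1)])
    show "?P' \<otimes>\<^bsub>form_monoid\<^esub> ?P = \<one>\<^bsub>form_monoid\<^esub>"
      by (rule mult_inverse_form_monoid[OF \<chi>' \<chi>(1) inv(2)])
    show "?Q' \<otimes>\<^bsub>form_monoid\<^esub> ?Q = \<one>\<^bsub>form_monoid\<^esub>"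
      by (rule product_inverse_form_monoid[OF \<chi>' \<chi>(1) inv(2)])
    show "cut_form (\<lambda>a b. J b a) \<otimes>\<^bsub>form_monoid\<^esub> cut_form L = \<one>\<^bsub>form_monoid\<^esub>"
      by (rule convolution2_inverse_form_monoid(1)[OF L])
    show "cut_form L' \<otimes>\<^bsub>form_monoid\<^esub> (?P \<otimes>\<^bsub>form_monoid\<^esub> cut_form (\<lambda>a b. J b a) \<otimes>\<^bsub>form_monoid\<^esub> ?Q') =
        \<one>\<^bsub>form_monoid\<^esub>"
      unfolding J'_flip[symmetric] by (rule convolution2_inverse_form_monoid(2)[OF L'])
  qed
  then have "cut_form L' \<otimes>\<^bsub>form_monoid\<^esub> cut_form J' =
    ?Q \<otimes>\<^bsub>form_monoid\<^esub> (cut_form L \<otimes>\<^bsub>form_monoid\<^esub> cut_form J) \<otimes>\<^bsub>form_monoid\<^esub> ?Q'"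
    unfolding J' .
  then have R: "cut_form (convolution2 \<A> L' J') =
      cut_form (convolution2 \<A> (convolution2 \<A> (\<lambda>a b. \<chi> a * \<chi> b) (convolution2 \<A> L J)) (\<lambda>a b. \<chi>' a * \<chi>' b))"
    unfolding mult_form_monoid .
  have bilR: "bilinear_form \<A> (convolution2 \<A> L J)"
    by (rule bilinear_form_convolution2[OF convolution2_inverse_bilinear[OF L] bil(1)])
  have "R_form \<A> J' a b = convolution2 \<A> (convolution2 \<A> (\<lambda>a b. \<chi> a * \<chi> b) (convolution2 \<A> L J))
      (\<lambda>a b. \<chi>' a * \<chi>' b) a b"
    unfolding R_form_def L'_def[symmetric] by (rule cut_form_eqD[OF R ab])
  also have "\<dots> = convolution2 \<A> (\<lambda>a b. \<chi> a * \<chi> b) (convolution2 \<A> L J) (left_act \<chi>' a) (left_act \<chi>' b)"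
    by (rule convolution2_product_right[OF bilinear_form_convolution2[OF bilinear_form_product[OF \<chi>(1,1)] bilR] \<chi>' \<chi>' ab])
  also have "\<dots> = convolution2 \<A> L J (right_act \<chi> (left_act \<chi>' a)) (right_act \<chi> (left_act \<chi>' b))"
    by (rule convolution2_product_left[OF bilR \<chi>(1,1) left_act_closed[OF \<chi>' ab(1)] left_act_closed[OF \<chi>' ab(2)]])
  finally show ?thesis
    unfolding R_form_def L_def .
qed

lemma minimal_form_gauge:
  assumes \<chi>: "linear_form \<A> \<chi>" "convolution_inverse \<A> \<chi> \<chi>'"
    and J: "hopf_2cocycle \<A> J" "hopf_2cocycle \<A> J'"
    and gauge: "\<And>a b. a \<in> \<O> \<Longrightarrow> b \<in> \<O> \<Longrightarrow> J' a b =
      convolution2 \<A> (convolution2 \<A> (\<lambda>x y. \<chi> (x \<otimes>\<^bsub>\<A>\<^esub> y)) J) (\<lambda>x y. \<chi>' x * \<chi>' y) a b"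
    and minimal: "minimal_form \<A> J'"
  shows "minimal_form \<A> J"
proof -
  note \<chi>' = convolution_inverse_linear[OF \<chi>(2)]
  let ?o = "\<lambda>x\<in>carrier G. 0 :: complex"
  have o: "?o \<in> \<O>"
    by (rule regular_functions_intros)
  have "a = ?o" if a: "a \<in> \<O>" and R: "\<And>b. b \<in> \<O> \<Longrightarrow> R_form \<A> J b a = 0" for a
  proof -
    \<comment> \<open>The preimage of a under the bijection by which the arguments of R^J' and R^J
      differ.\<close>
    define a' where "a' = left_act \<chi> (right_act \<chi>' a)"
    have a': "a' \<in> \<O>"
      unfolding a'_def by (intro left_act_closed right_act_closed \<chi> \<chi>' a)
    have a_eq: "right_act \<chi> (left_act \<chi>' a') = a"
      unfolding a'_def
      by (simp only: convolution_inverse_act(2)[OF \<chi> right_act_closed[OF \<chi>' a]]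
          convolution_inverse_act(3)[OF \<chi> a])
    have "R_form \<A> J' b a' = 0" if b: "b \<in> \<O>" for b
    proof -
      have "R_form \<A> J' b a' = R_form \<A> J (right_act \<chi> (left_act \<chi>' b)) a"
        using R_form_gauge[OF \<chi> J gauge b a'] unfolding a_eq by blast
      also have "\<dots> = 0"
        by (intro R right_act_closed left_act_closed \<chi> \<chi>' b)
      finally show ?thesis .
    qed
    then have "a' = ?o"
      using minimal a' unfolding minimal_form_def by auto
    moreover have "left_act \<chi>' ?o = ?o"
      using linear_form_zero[OF \<chi>'] by (auto simp: left_act_def left_translate_def cong: restrict_cong)
    moreover have "right_act \<chi> ?o = ?o"
      using linear_form_zero[OF \<chi>(1)] by (auto simp: right_act_def right_translate_def cong: restrict_cong)
    ultimately show ?thesis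
      using a_eq by simp
  qed
  moreover have "R_form \<A> J b ?o = 0" if "b \<in> \<O>" for b
  proof (rule linear_form_zero)
    have "bilinear_form \<A> (R_form \<A> J)"
      unfolding R_form_def
      by (rule bilinear_form_convolution2[OF convolution2_inverse_bilinear[OF hopf_2cocycle_flip_inverse[OF J(1)]]])
        (use J(1) in \<open>simp add: hopf_2cocycle_def\<close>)
    then show "linear_form \<A> (R_form \<A> J b)"
      using that bilinear_formD(1)[of \<A> "R_form \<A> J" b] by simp
  qed
  ultimately show ?thesis
    unfolding minimal_form_def regular_bialgebra_simps using o by blast
qed

end

section \<open>The Nullstellensatz over the complex numbers\<close>

lemma poly_functions_intros:
  "(\<lambda>_. c) \<in> poly_functions"
  "(\<lambda>x. x i) \<in> poly_functions"
  "f \<in> poly_functions \<Longrightarrow> g \<in> poly_functions \<Longrightarrow> (\<lambda>x. f x + g x) \<in> poly_functions"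
  "f \<in> poly_functions \<Longrightarrow> g \<in> poly_functions \<Longrightarrow> (\<lambda>x. f x * g x) \<in> poly_functions"
  unfolding poly_functions_def by (auto intro: generated_functions.intros)

lemma poly_functions_diff:
  assumes "f \<in> poly_functions" "g \<in> poly_functions"
  shows "(\<lambda>x. f x - g x) \<in> poly_functions"
  using poly_functions_intros(3)[OF assms(1) poly_functions_intros(4)[OF poly_functions_intros(1)[of "-1"] assms(2)]]
  by simp

lemma poly_functions_poly: "(\<lambda>x. poly p (x i)) \<in> poly_functions"
proof (induction p)
  case (pCons a p)
  have "(\<lambda>x. a + x i * poly p (x i)) \<in> poly_functions"
    by (intro poly_functions_intros pCons.IH)
  then show ?case
    by simp
qed (simp add: poly_functions_intros)

section \<open>Countable dimension of the space of polynomial functions\<close>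

global_interpretation pointwise: vector_space "\<lambda>c (f :: 'p \<Rightarrow> complex) x. c * f x"
  by unfold_locales (auto simp: fun_eq_iff algebra_simps)

text \<open>Lists of variable indices, with repetition in place of exponents, form a countable type;
  that different lists may give the same monomial is harmless for spanning.\<close>

definition monomial :: "nat list \<Rightarrow> point \<Rightarrow> complex" where
  "monomial l x = (\<Prod>i\<leftarrow>l. x i)"

lemma monomial_mult_span:
  assumes "g \<in> pointwise.span (range monomial)"
  shows "(\<lambda>x. monomial l x * g x) \<in> pointwise.span (range monomial)"
  using assms
proof (induction rule: pointwise.span_induct_alt)
  case base
  show ?case
    using pointwise.span_zero by (simp add: zero_fun_def)
next
  case (step c m g)
  then obtain l' where "m = monomial l'"
    by blast
  then have "(\<lambda>x. monomial l x * ((\<lambda>x. c * m x) + g) x) =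
      (\<lambda>x. c * monomial (l @ l') x) + (\<lambda>x. monomial l x * g x)"
    by (auto simp: fun_eq_iff monomial_def algebra_simps)
  moreover have "\<dots> \<in> pointwise.span (range monomial)"
    by (intro pointwise.span_add pointwise.span_scale pointwise.span_base step.IH) simp
  ultimately show ?case
    by simp
qed

lemma span_monomial_mult:
  assumes "f \<in> pointwise.span (range monomial)" "g \<in> pointwise.span (range monomial)"
  shows "(\<lambda>x. f x * g x) \<in> pointwise.span (range monomial)"
  using assms(1)
proof (induction rule: pointwise.span_induct_alt)
  case base
  show ?case
    using pointwise.span_zero by (simp add: zero_fun_def)
next
  case (step c m f)
  then have "(\<lambda>x. ((\<lambda>x. c * m x) + f) x * g x) = (\<lambda>x. c * (m x * g x)) + (\<lambda>x. f x * g x)"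
    by (auto simp: fun_eq_iff algebra_simps)
  then show ?case
    using step monomial_mult_span[OF assms(2)]
    by (auto intro!: pointwise.span_add pointwise.span_scale)
qed

lemma poly_functions_subset_span: "poly_functions \<subseteq> pointwise.span (range monomial)"
proof
  fix f assume "f \<in> poly_functions"
  then show "f \<in> pointwise.span (range monomial)"
    unfolding poly_functions_def
  proof induction
    case (const c)
    have "(\<lambda>_. c) = (\<lambda>x. c * monomial [] x)"
      by (simp add: monomial_def)
    moreover have "\<dots> \<in> pointwise.span (range monomial)"
      by (intro pointwise.span_scale pointwise.span_base) simp
    ultimately show ?case
      by simp
  next
    case (gen f)
    then obtain i where "f = (\<lambda>x. x i)"
      by blast
    then have "f = monomial [i]"
      by (simp add: monomial_def fun_eq_iff)
    then show ?case
      by (auto intro: pointwise.span_base)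
  next
    case (add f g)
    then show ?case
      using pointwise.span_add[OF add.IH] by (simp add: plus_fun_def)
  next
    case (mult f g)
    then show ?case
      by (intro span_monomial_mult)
  qed
qed

section \<open>Ideals of polynomial functions and their zeros\<close>

definition poly_ideal :: "(point \<Rightarrow> complex) set \<Rightarrow> bool" where
  "poly_ideal I \<longleftrightarrow> I \<subseteq> poly_functions \<and> (\<lambda>_. 0) \<in> I \<and>
    (\<forall>f\<in>I. \<forall>g\<in>I. (\<lambda>x. f x + g x) \<in> I) \<and> (\<forall>f\<in>I. \<forall>g\<in>poly_functions. (\<lambda>x. g x * f x) \<in> I)"

lemma poly_idealD:
  assumes "poly_ideal I"
  shows "I \<subseteq> poly_functions" "(\<lambda>_. 0) \<in> I"
    "\<And>f g. f \<in> I \<Longrightarrow> g \<in> I \<Longrightarrow> (\<lambda>x. f x + g x) \<in> I"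
    "\<And>f g. f \<in> I \<Longrightarrow> g \<in> poly_functions \<Longrightarrow> (\<lambda>x. g x * f x) \<in> I"
    "\<And>f g. f \<in> I \<Longrightarrow> g \<in> I \<Longrightarrow> (\<lambda>x. f x - g x) \<in> I"
proof -
  show add: "\<And>f g. f \<in> I \<Longrightarrow> g \<in> I \<Longrightarrow> (\<lambda>x. f x + g x) \<in> I"
    and "I \<subseteq> poly_functions" "(\<lambda>_. 0) \<in> I"
    and mult: "\<And>f g. f \<in> I \<Longrightarrow> g \<in> poly_functions \<Longrightarrow> (\<lambda>x. g x * f x) \<in> I"
    using assms by (auto simp: poly_ideal_def)
  show "(\<lambda>x. f x - g x) \<in> I" if "f \<in> I" "g \<in> I" for f g
    using add[OF that(1) mult[OF that(2) poly_functions_intros(1)[of "-1"]]] by simp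
qed

lemma poly_ideal_sum:
  assumes "poly_ideal I" "\<And>i. i \<in> A \<Longrightarrow> f i \<in> I"
  shows "(\<lambda>x. \<Sum>i\<in>A. f i x) \<in> I"
  using assms(2)
  by (induction A rule: infinite_finite_induct) (auto intro: poly_idealD[OF assms(1)])

text \<open>Every linear factor of p is a unit modulo I, so p can be divided by its roots one after
  another until a nonzero constant lies in I.\<close>

lemma poly_ideal_univariate:
  assumes I: "poly_ideal I" and unit: "\<And>c. \<exists>r\<in>poly_functions. (\<lambda>x. (x i - c) * r x - 1) \<in> I"
    and "p \<noteq> 0" "(\<lambda>x. poly p (x i)) \<in> I"
  shows "(\<lambda>_. 1) \<in> I"
  using assms(3,4)
proof (induction "degree p" arbitrary: p rule: less_induct)
  case less
  show ?case
  proof (cases "degree p = 0")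
    case True
    then obtain a where a: "p = [:a:]" "a \<noteq> 0"
      using less.prems(1) by (auto elim: degree_eq_zeroE)
    then show ?thesis
      using poly_idealD(4)[OF I less.prems(2) poly_functions_intros(1)[of "1 / a"]] by simp
  next
    case False
    then obtain d where "poly p d = 0"
      using fundamental_theorem_of_algebra[of p] constant_degree[of p] by auto
    then obtain q where q: "p = [:- d, 1:] * q"
      by (auto simp: poly_eq_0_iff_dvd)
    then have "q \<noteq> 0"
      using less.prems(1) by auto
    moreover from this have "degree q < degree p"
      unfolding q by (subst degree_mult_eq) auto
    moreover have "(\<lambda>x. poly q (x i)) \<in> I"
    proof -
      obtain r where r: "r \<in> poly_functions" "(\<lambda>x. (x i - d) * r x - 1) \<in> I"
        using unit by blast
      \<comment> \<open>Here p is \<open>(x i - d)\<close> times q and r inverts that factor modulo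
        I; the combination simplifies to q exactly.\<close>
      have "(\<lambda>x. r x * poly p (x i) - poly q (x i) * ((x i - d) * r x - 1)) \<in> I"
        by (intro poly_idealD(4,5)[OF I] less.prems r poly_functions_poly)
      then show ?thesis
        by (simp add: q algebra_simps)
    qed
    ultimately show ?thesis
      using less.hyps by blast
  qed
qed

text \<open>
  If every \<open>x i - c\<close> were invertible modulo \<open>I\<close>, the inverses would be uncountably many elements of
  a space of countable dimension; a linear relation between them yields a nonzero polynomial in
  \<open>x i\<close> lying in \<open>I\<close>.
\<close>

lemma poly_ideal_coordinate:
  assumes I: "poly_ideal I" and proper: "(\<lambda>_. 1) \<notin> I"
  shows "\<exists>c. \<forall>r\<in>poly_functions. (\<lambda>x. (x i - c) * r x - 1) \<notin> I"
proof (rule ccontr)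
  assume "\<not> ?thesis"
  then have unit: "\<And>c. \<exists>r\<in>poly_functions. (\<lambda>x. (x i - c) * r x - 1) \<in> I"
    by blast
  define r where "r c = (SOME r. r \<in> poly_functions \<and> (\<lambda>x. (x i - c) * r x - 1) \<in> I)" for c
  have "r c \<in> poly_functions \<and> (\<lambda>x. (x i - c) * r c x - 1) \<in> I" for c
    unfolding r_def by (rule someI_ex[of "\<lambda>r. r \<in> poly_functions \<and> (\<lambda>x. (x i - c) * r x - 1) \<in> I"])
      (use unit in blast)
  then have r: "\<And>c. r c \<in> poly_functions" "\<And>c. (\<lambda>x. (x i - c) * r c x - 1) \<in> I"
    by auto
  \<comment> \<open>A common inverse r for c and d would give (d - c) r in I, then r in I, and
    finally 1 in I.\<close>
  have inj: "inj r"
  proof (rule injI, rule ccontr)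
    fix c d assume eq: "r c = r d" and "c \<noteq> d"
    have "(\<lambda>x. ((x i - c) * r c x - 1) - ((x i - d) * r c x - 1)) \<in> I"
      using poly_idealD(5)[OF I r(2)[of c] r(2)[of d]] eq by simp
    from poly_idealD(4)[OF I this poly_functions_intros(1)[of "1 / (d - c)"]]
    have "(\<lambda>x. 1 / (d - c) * ((x i - c) * r c x - 1 - ((x i - d) * r c x - 1))) \<in> I" .
    moreover have "1 / (d - c) * ((y - c) * w - 1 - ((y - d) * w - 1)) = w" for y w
      using \<open>c \<noteq> d\<close> by (simp add: field_simps)
    ultimately have "r c \<in> I"
      by simp
    have "(\<lambda>x. (x i - c) * r c x - ((x i - c) * r c x - 1)) \<in> I"
      by (intro poly_idealD(4,5)[OF I] \<open>r c \<in> I\<close> r poly_functions_diff poly_functions_intros)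
    then show False
      using proper by simp
  qed
  have "\<forall>c. \<exists>T. finite T \<and> T \<subseteq> range monomial \<and> r c \<in> pointwise.span T"
  proof
    fix c
    have "r c \<in> pointwise.span (range monomial)"
      using poly_functions_subset_span r(1) by blast
    then obtain t u where t: "finite t" "t \<subseteq> range monomial" "r c = (\<Sum>m\<in>t. (\<lambda>x. u m * m x))"
      unfolding pointwise.span_explicit by auto
    have "r c \<in> pointwise.span t"
      unfolding t(3) by (intro pointwise.span_sum pointwise.span_scale pointwise.span_base)
    then show "\<exists>T. finite T \<and> T \<subseteq> range monomial \<and> r c \<in> pointwise.span T"
      using t(1,2) by blast
  qed
  from choice[OF this] obtain T where T: "\<And>c. finite (T c)" "\<And>c. T c \<subseteq> range monomial"
    "\<And>c. r c \<in> pointwise.span (T c)"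
    by blast
  \<comment> \<open>Pigeonhole: there are uncountably many c but only countably many finite sets of
    monomials. Infinitely many of the inverses then share one finite-dimensional span.\<close>
  have "\<exists>S. infinite {c. T c = S}"
  proof (rule ccontr)
    assume "\<not> ?thesis"
    then have fin: "countable {c. T c = S}" for S
      by (simp add: countable_finite)
    have "countable {S. finite S \<and> S \<subseteq> range monomial}"
      by (rule countable_Collect_finite_subset) simp
    from countable_UN[OF this fin]
    have "countable (\<Union>S\<in>{S. finite S \<and> S \<subseteq> range monomial}. {c. T c = S})" .
    moreover have "UNIV \<subseteq> (\<Union>S\<in>{S. finite S \<and> S \<subseteq> range monomial}. {c. T c = S})"
    proof
      fix c
      show "c \<in> (\<Union>S\<in>{S. finite S \<and> S \<subseteq> range monomial}. {c. T c = S})"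
        using T(1)[of c] T(2)[of c] by (intro UN_I[of "T c"] CollectI conjI refl)
    qed
    ultimately have "countable (UNIV :: complex set)"
      by (rule countable_subset[rotated])
    with uncountable_UNIV_complex show False
      by (rule notE)
  qed
  then obtain S where inf: "infinite {c. T c = S}"
    by blast
  then have "{c. T c = S} \<noteq> {}"
    by (rule infinite_imp_nonempty)
  then obtain c where "T c = S"
    by auto
  with T(1)[of c] have "finite S"
    by simp
  have "infinite (r ` {c. T c = S})"
    using inf finite_imageD[OF _ inj_on_subset[OF inj subset_UNIV]] by blast
  moreover have "r ` {c. T c = S} \<subseteq> pointwise.span S"
    using T(3) by auto
  ultimately have "pointwise.dependent (r ` {c. T c = S})"
    using pointwise.independent_span_bound[OF \<open>finite S\<close>, of "r ` {c. T c = S}"] by argo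
  then have "\<exists>t u. finite t \<and> t \<subseteq> r ` {c. T c = S} \<and>
      (\<Sum>v\<in>t. (\<lambda>x. u v * v x)) = 0 \<and> (\<exists>v\<in>t. u v \<noteq> 0)"
    unfolding pointwise.dependent_explicit by blast
  then obtain t u where t: "finite t" "t \<subseteq> r ` {c. T c = S}"
    "(\<Sum>v\<in>t. (\<lambda>x. u v * v x)) = 0" "\<exists>v\<in>t. u v \<noteq> 0"
    by auto
  obtain D where D: "t = r ` D" "finite D"
    using finite_subset_image[OF t(1,2)] by auto
  then obtain c0 where c0: "c0 \<in> D" "u (r c0) \<noteq> 0"
    using t(4) by auto
  have rel: "(\<Sum>c\<in>D. u (r c) * r c x) = 0" for x
  proof -
    have "(\<Sum>c\<in>D. u (r c) * r c x) = (\<Sum>v\<in>t. u v * v x)"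
      using inj by (simp add: D(1) sum.reindex inj_on_def)
    also have "\<dots> = (\<Sum>v\<in>t. (\<lambda>x. u v * v x)) x"
      by (induction t rule: infinite_finite_induct) auto
    finally show ?thesis
      using t(3) by simp
  qed
  \<comment> \<open>Since \<open>r c\<close> stands for 1/(x_i - c), p is the numerator obtained by
    clearing denominators in the relation \<open>rel\<close>. As in Lagrange interpolation, only the
    term of \<open>c0\<close> survives at \<open>c0\<close>, so p is nonzero.\<close>
  define q where "q c = (\<Prod>d\<in>D - {c}. [:- d, 1:])" for c
  define p where "p = (\<Sum>c\<in>D. smult (u (r c)) (q c))"
  have q: "poly (q c) y = (\<Prod>d\<in>D - {c}. y - d)" for c y
    by (simp add: q_def poly_prod)
  have "poly p c0 = (\<Sum>c\<in>D. if c = c0 then u (r c) * poly (q c) c0 else 0)"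
    unfolding p_def poly_sum
  proof (rule sum.cong)
    fix c assume "c \<in> D"
    show "poly (smult (u (r c)) (q c)) c0 = (if c = c0 then u (r c) * poly (q c) c0 else 0)"
      using D(2) c0(1) by (auto simp: q)
  qed simp
  also have "\<dots> \<noteq> 0"
    using D(2) c0 by (simp add: q)
  finally have "p \<noteq> 0"
    by auto
  \<comment> \<open>Each summand is the corresponding term of p minus the full product over D times
    \<open>u (r c) * r c x\<close>; the subtracted parts add up to zero by
    \<open>rel\<close>.\<close>
  have "(\<lambda>x. \<Sum>c\<in>D. (- u (r c) * poly (q c) (x i)) * ((x i - c) * r c x - 1)) \<in> I"
    by (intro poly_ideal_sum[OF I] poly_idealD(4)[OF I r(2)] poly_functions_intros poly_functions_poly)
  moreover have "(\<Sum>c\<in>D. (- u (r c) * poly (q c) (x i)) * ((x i - c) * r c x - 1)) = poly p (x i)" for x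
  proof -
    have "poly (q c) (x i) * (x i - c) = (\<Prod>d\<in>D. x i - d)" if "c \<in> D" for c
      using that D(2) by (simp add: q prod.remove[of D c] mult.commute)
    then have "(- u (r c) * poly (q c) (x i)) * ((x i - c) * r c x - 1) =
        poly (smult (u (r c)) (q c)) (x i) - (\<Prod>d\<in>D. x i - d) * (u (r c) * r c x)" if "c \<in> D" for c
      using that by (simp add: right_diff_distrib)
    then have "(\<Sum>c\<in>D. (- u (r c) * poly (q c) (x i)) * ((x i - c) * r c x - 1)) =
      poly p (x i) - (\<Prod>d\<in>D. x i - d) * (\<Sum>c\<in>D. u (r c) * r c x)"
      by (simp add: p_def poly_sum sum_subtractf sum_distrib_left)
    then show ?thesis
      by (simp add: rel)
  qed
  ultimately have "(\<lambda>x. poly p (x i)) \<in> I"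
    by simp
  then show False
    using poly_ideal_univariate[OF I unit \<open>p \<noteq> 0\<close>] proper by blast
qed

text \<open>All countably many coordinates are allowed, so the zero is a sequence that need not lie
  in any affine n-space. A maximal ideal above I contains some x_i - c_i for each i, and these c_i
  are the coordinates of the zero.\<close>

lemma nullstellensatz:
  assumes I: "poly_ideal I" and proper: "(\<lambda>_. 1) \<notin> I"
  shows "\<exists>c. \<forall>f\<in>I. f c = 0"
proof -
  define \<A> where "\<A> = {M. poly_ideal M \<and> (\<lambda>_. 1) \<notin> M \<and> I \<subseteq> M}"
  have "\<exists>M\<in>\<A>. \<forall>N\<in>\<A>. M \<subseteq> N \<longrightarrow> N = M"
  proof (rule subset_Zorn_nonempty)
    show "\<A> \<noteq> {}"
      using assms by (auto simp: \<A>_def)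
    show "\<Union>\<C> \<in> \<A>" if "\<C> \<noteq> {}" "subset.chain \<A> \<C>" for \<C>
    proof -
      have C: "poly_ideal M" "(\<lambda>_. 1) \<notin> M" "I \<subseteq> M" if "M \<in> \<C>" for M
        using that \<open>subset.chain \<A> \<C>\<close> by (auto simp: \<A>_def subset_chain_def)
      have "(\<lambda>x. f x + g x) \<in> \<Union>\<C>" if fg: "f \<in> \<Union>\<C>" "g \<in> \<Union>\<C>" for f g
      proof -
        obtain M N where "M \<in> \<C>" "f \<in> M" "N \<in> \<C>" "g \<in> N"
          using fg by blast
        moreover have "M \<subseteq> N \<or> N \<subseteq> M"
          using \<open>subset.chain \<A> \<C>\<close> \<open>M \<in> \<C>\<close> \<open>N \<in> \<C>\<close> by (auto simp: subset_chain_def)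
        ultimately show ?thesis
          using poly_idealD(3)[OF C(1)] by blast
      qed
      moreover have "(\<lambda>x. g x * f x) \<in> \<Union>\<C>" if "f \<in> \<Union>\<C>" "g \<in> poly_functions" for f g
        using that poly_idealD(4)[OF C(1)] by blast
      moreover have "\<Union>\<C> \<subseteq> poly_functions"
        using poly_idealD(1)[OF C(1)] by blast
      ultimately have "poly_ideal (\<Union>\<C>)"
        using that(1) poly_idealD(2)[OF C(1)] unfolding poly_ideal_def
        by (intro conjI ballI) (assumption | blast)+
      moreover have "I \<subseteq> \<Union>\<C>"
        using C(3) that(1) by blast
      ultimately show ?thesis
        using C(2) by (auto simp: \<A>_def)
    qed
  qed
  then obtain M where M: "poly_ideal M" "(\<lambda>_. 1) \<notin> M" "I \<subseteq> M"
    and max: "\<And>N. poly_ideal N \<Longrightarrow> (\<lambda>_. 1) \<notin> N \<Longrightarrow> M \<subseteq> N \<Longrightarrow> N = M"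
    unfolding \<A>_def by (auto; metis order_trans)
  have "\<exists>c. (\<lambda>x. x i - c) \<in> M" for i
  proof -
    obtain c where c: "\<And>r. r \<in> poly_functions \<Longrightarrow> (\<lambda>x. (x i - c) * r x - 1) \<notin> M"
      using poly_ideal_coordinate[OF M(1,2)] by blast
    \<comment> \<open>The ideal generated by M and \<open>x i - c\<close>. It is proper since
      \<open>x i - c\<close> is not invertible modulo M, so by maximality \<open>x i - c\<close>
      already lies in M.\<close>
    define N where "N = {\<lambda>x. f x + (x i - c) * r x | f r. f \<in> M \<and> r \<in> poly_functions}"
    have N: "(\<lambda>x. f x + (x i - c) * r x) \<in> N" if "f \<in> M" "r \<in> poly_functions" for f r
      using that by (auto simp: N_def)
    have "poly_ideal N"
      unfolding poly_ideal_def
    proof (intro conjI ballI)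
      show "N \<subseteq> poly_functions"
      proof
        fix g assume "g \<in> N"
        then obtain f r where "f \<in> poly_functions" "r \<in> poly_functions" "g = (\<lambda>x. f x + (x i - c) * r x)"
          using poly_idealD(1)[OF M(1)] by (auto simp: N_def)
        then show "g \<in> poly_functions"
          by (simp only:) (intro poly_functions_intros poly_functions_diff)
      qed
      show "(\<lambda>_. 0) \<in> N"
        using N[OF poly_idealD(2)[OF M(1)] poly_functions_intros(1)[of 0]] by simp
    next
      fix f g assume "f \<in> N" "g \<in> N"
      then obtain f' r g' s where fg: "f' \<in> M" "r \<in> poly_functions" "f = (\<lambda>x. f' x + (x i - c) * r x)"
        "g' \<in> M" "s \<in> poly_functions" "g = (\<lambda>x. g' x + (x i - c) * s x)"
        by (auto simp: N_def)
      then show "(\<lambda>x. f x + g x) \<in> N"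
        using N[OF poly_idealD(3)[OF M(1) fg(1,4)] poly_functions_intros(3)[OF fg(2,5)]]
        by (simp add: algebra_simps)
    next
      fix f g assume "f \<in> N" and g: "g \<in> poly_functions"
      then obtain f' r where f: "f' \<in> M" "r \<in> poly_functions" "f = (\<lambda>x. f' x + (x i - c) * r x)"
        by (auto simp: N_def)
      then show "(\<lambda>x. g x * f x) \<in> N"
        using N[OF poly_idealD(4)[OF M(1) f(1) g] poly_functions_intros(4)[OF g f(2)]]
        by (simp add: algebra_simps)
    qed
    moreover have "(\<lambda>_. 1) \<notin> N"
    proof
      assume "(\<lambda>_. 1) \<in> N"
      then obtain f r where f: "f \<in> M" "r \<in> poly_functions" "(\<lambda>_. 1) = (\<lambda>x. f x + (x i - c) * r x)"
        by (auto simp: N_def)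
      then have "(\<lambda>x. (x i - c) * r x - 1) = (\<lambda>x. -1 * f x)"
        by (simp add: fun_eq_iff) (metis add_diff_cancel_left' diff_add_cancel minus_diff_eq)
      then show False
        using c[OF f(2)] poly_idealD(4)[OF M(1) f(1) poly_functions_intros(1)[of "-1"]] by simp
    qed
    moreover have "M \<subseteq> N"
      using N[OF _ poly_functions_intros(1)[of 0]] by auto
    ultimately have "N = M"
      by (rule max)
    moreover have "(\<lambda>x. x i - c) \<in> N"
      using N[OF poly_idealD(2)[OF M(1)] poly_functions_intros(1)[of 1]] by simp
    ultimately show ?thesis
      by blast
  qed
  then obtain c where c: "\<And>i. (\<lambda>x. x i - c i) \<in> M"
    by metis
  \<comment> \<open>Modulo M every polynomial is congruent to its value at c. An f in I with nonzero
    value there would put a nonzero constant into M.\<close>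
  have diff_M: "(\<lambda>x. f x - f c) \<in> M" if "f \<in> poly_functions" for f
    using that unfolding poly_functions_def
  proof induction
    case (const a)
    show ?case
      using poly_idealD(2)[OF M(1)] by simp
  next
    case (gen f)
    then show ?case
      using c by auto
  next
    case (add f g)
    then show ?case
      using poly_idealD(3)[OF M(1) add.IH] by (simp add: algebra_simps)
  next
    case (mult f g)
    have "(\<lambda>x. g x * (f x - f c) + f c * (g x - g c)) \<in> M"
      using mult by (intro poly_idealD(3,4)[OF M(1)] poly_functions_intros) (auto simp: poly_functions_def)
    then show ?case
      by (simp add: algebra_simps)
  qed
  have "f c = 0" if "f \<in> I" for f
  proof (rule ccontr)
    assume "f c \<noteq> 0"
    have "f \<in> M" "f \<in> poly_functions"
      using that M(3) poly_idealD(1)[OF M(1)] by auto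
    have "(\<lambda>x. f x - (f x - f c)) \<in> M"
      by (rule poly_idealD(5)[OF M(1) \<open>f \<in> M\<close> diff_M[OF \<open>f \<in> poly_functions\<close>]])
    from poly_idealD(4)[OF M(1) this poly_functions_intros(1)[of "1 / f c"]]
    have "(\<lambda>x. 1 / f c * (f x - (f x - f c))) \<in> M" .
    then show False
      using M(2) \<open>f c \<noteq> 0\<close> by simp
  qed
  then show ?thesis
    by blast
qed

text \<open>The denominators of a locally rational function generate the unit ideal.\<close>

lemma functions_on_affine_function_space:
  assumes X: "closedin (zariski n) X"
    and f: "f \<in> functions_on (affine_function_space n X) X"
  shows "\<exists>p\<in>poly_functions. \<forall>x\<in>X. f x = p x"
proof -
  \<comment> \<open>The polynomial denominators that work for f on all of X; the goal is that 1 is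
    one of them.\<close>
  define I where "I = {q \<in> poly_functions. \<exists>p\<in>poly_functions. \<forall>x\<in>X. q x * f x = p x}"
  have I: "poly_ideal I"
    unfolding poly_ideal_def
  proof (intro conjI ballI)
    show "I \<subseteq> poly_functions"
      by (auto simp: I_def)
    show "(\<lambda>_. 0) \<in> I"
      unfolding I_def using poly_functions_intros(1)[of 0] by force
  next
    fix q q' assume "q \<in> I" "q' \<in> I"
    then obtain p p' where "p \<in> poly_functions" "\<forall>x\<in>X. q x * f x = p x"
      "p' \<in> poly_functions" "\<forall>x\<in>X. q' x * f x = p' x" "q \<in> poly_functions" "q' \<in> poly_functions"
      by (auto simp: I_def)
    then show "(\<lambda>x. q x + q' x) \<in> I"
      unfolding I_def
      by (intro CollectI conjI bexI[of _ "\<lambda>x. p x + p' x"] poly_functions_intros(3)) (simp_all add: algebra_simps)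
  next
    fix q g assume "q \<in> I" and g: "g \<in> poly_functions"
    then obtain p where "p \<in> poly_functions" "\<forall>x\<in>X. q x * f x = p x" "q \<in> poly_functions"
      by (auto simp: I_def)
    then show "(\<lambda>x. g x * q x) \<in> I"
      unfolding I_def using g
      by (intro CollectI conjI bexI[of _ "\<lambda>x. g x * p x"] poly_functions_intros(4)) (simp_all add: mult.assoc)
  qed
  have "(\<lambda>_. 1) \<in> I"
  proof (rule ccontr)
    assume "(\<lambda>_. 1) \<notin> I"
    then obtain c where c: "\<And>q. q \<in> I \<Longrightarrow> q c = 0"
      using nullstellensatz[OF I] by blast
    \<comment> \<open>Polynomials vanishing on X are denominators with numerator 0. Hence c
      satisfies the equations of X, and the coordinates from n on, which vanish on X, place c in the
      affine space.\<close>
    have vanish: "p c = 0" if "p \<in> poly_functions" "\<forall>x\<in>X. p x = 0" for p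
    proof (rule c)
      show "p \<in> I"
        unfolding I_def using that
        by (intro CollectI conjI bexI[of _ "\<lambda>_. 0"] poly_functions_intros(1)) simp_all
    qed
    obtain F where F: "F \<subseteq> poly_functions" "X = {x \<in> affine_space n. \<forall>f\<in>F. f x = 0}"
      using X by (auto simp: closedin_zariski)
    have "c \<in> X"
    proof -
      have "c i = 0" if "i \<ge> n" for i
        using that F(2) by (intro vanish[OF poly_functions_intros(2)]) (simp add: affine_space_def)
      moreover have "f c = 0" if "f \<in> F" for f
        using that F by (intro vanish) auto
      ultimately show ?thesis
        unfolding F(2) by (simp add: affine_space_def)
    qed
    then obtain V p q where V: "openin (subtopology (zariski n) X) V" "c \<in> V" "V \<subseteq> X"
      "p \<in> poly_functions" "q \<in> poly_functions" "\<And>y. y \<in> V \<Longrightarrow> q y \<noteq> 0 \<and> f y = p y / q y"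
      using f by (auto simp: affine_function_space_def)
    then obtain F' where F': "F' \<subseteq> poly_functions" "V = {x \<in> affine_space n. \<exists>f\<in>F'. f x \<noteq> 0} \<inter> X"
      by (auto simp: openin_subtopology openin_zariski)
    \<comment> \<open>q is a denominator of f on V only. As h vanishes on X outside V, the product
      of h and q is a denominator on all of X, and it is nonzero at c.\<close>
    then obtain h where h: "h \<in> F'" "h c \<noteq> 0"
      using V(2) by blast
    have "h x * q x * f x = h x * p x" if "x \<in> X" for x
    proof (cases "x \<in> V")
      case True
      then show ?thesis
        using V(6) by simp
    next
      case False
      then have "h x = 0"
        using that F'(2) h(1) F(2) by auto
      then show ?thesis
        by simp
    qed
    moreover have "h \<in> poly_functions"
      using h(1) F'(1) by blast
    ultimately have "(\<lambda>x. h x * q x) \<in> I"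
      unfolding I_def using V(4,5)
      by (intro CollectI conjI bexI[of _ "\<lambda>x. h x * p x"] poly_functions_intros(4)) auto
    from c[OF this] show False
      using h(2) V(2,6) by simp
  qed
  then show ?thesis
    unfolding I_def by simp
qed

section \<open>The quotient variety and the main theorem\<close>

context affine_algebraic_group
begin

section \<open>Affine quotients without nonconstant functions\<close>

lemma left_coset_mult_right:
  assumes "subgroup H G" "g \<in> carrier G" "h \<in> H"
  shows "(g \<otimes> h) <# H = g <# H"
  using assms subgroup.subset[OF assms(1)] lcos_m_assoc[of H g h] coset_join3[of h H]
  by (auto simp: subset_iff)

lemma affine_quotient_variety_trivial:
  assumes H: "closed_subgroup n G H" and affine: "is_affine (quotient_variety n G H)"
    and trivial: "\<And>f. f \<in> right_invariants H \<Longrightarrow> \<exists>c. f = (\<lambda>x\<in>carrier G. c)"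
  shows "H = carrier G"
proof -
  have sub: "subgroup H G"
    using H by (simp add: closed_subgroup_def)
  let ?S = "quotient_variety n G H" and ?\<pi> = "\<lambda>g. g <# H"
  have top_G: "topspace (subtopology (zariski n) (carrier G)) = carrier G"
    using closedin_subset[OF closed] by (simp add: Int_absorb1)
  have top_S: "topspace (top_of ?S) = ?\<pi> ` carrier G"
    using quotient_imp_surjective_map[OF quotient_map_quotient_top[of "subtopology (zariski n) (carrier G)" ?\<pi>]]
    unfolding top_G by (simp add: quotient_variety_def quotient_function_space_def affine_function_space_def)
  have top_A: "topspace (top_of (affine_function_space n (carrier G))) = carrier G"
    using top_G by (simp add: affine_function_space_def)
  have functions_on_S: "f \<in> functions_on ?S U \<longleftrightarrow> f \<circ> ?\<pi> \<in> functions_on (affine_function_space n (carrier G))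
      {x \<in> topspace (top_of (affine_function_space n (carrier G))). ?\<pi> x \<in> U}" for f U
    by (simp only: quotient_variety_def quotient_function_space_def function_space.select_convs mem_Collect_eq)
  obtain m X \<phi> where X: "closedin (zariski m) X"
    and iso: "function_space_iso ?S (affine_function_space m X) \<phi>"
    using affine by (auto simp: is_affine_def)
  let ?T = "affine_function_space m X"
  have top_T: "topspace (top_of ?T) = X"
    using closedin_subset[OF X] by (simp add: affine_function_space_def Int_absorb1)
  have homeo: "homeomorphic_map (top_of ?S) (top_of ?T) \<phi>"
    and pullback: "\<And>U f. openin (top_of ?T) U \<Longrightarrow> f \<in> functions_on ?T U \<Longrightarrow>
      f \<circ> \<phi> \<in> functions_on ?S {x \<in> topspace (top_of ?S). \<phi> x \<in> U}"
    using iso unfolding function_space_iso_def by blast+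
  have image: "\<phi> ` (?\<pi> ` carrier G) = X"
    using homeomorphic_imp_surjective_map[OF homeo] unfolding top_S top_T .
  have inj: "inj_on \<phi> (?\<pi> ` carrier G)"
    using homeomorphic_imp_injective_map[OF homeo] unfolding top_S .
  have coordinate: "\<phi> (?\<pi> g) i = \<phi> (?\<pi> \<one>) i" if g: "g \<in> carrier G" for g i
  proof -
    \<comment> \<open>A coordinate of the affine model of G/H pulled back to G: constant on cosets
      by construction, and a priori only locally rational on G.\<close>
    define f where "f = (\<lambda>g. \<phi> (?\<pi> g) i)"
    have open_X: "openin (top_of ?T) X"
      using openin_topspace[of "top_of ?T"] unfolding top_T .
    have "(\<lambda>x. x i) \<in> functions_on ?T X"
      unfolding affine_function_space_def function_space.select_convs
    proof (intro CollectI ballI exI conjI)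
      show "openin (subtopology (zariski m) X) X"
        using open_X by (simp add: affine_function_space_def)
      show "\<exists>p\<in>poly_functions. \<exists>q\<in>poly_functions. \<forall>y\<in>X. q y \<noteq> 0 \<and> y i = p y / q y"
        by (rule bexI[of _ "\<lambda>y. y i"], rule bexI[of _ "\<lambda>_. 1"])
          (simp_all add: poly_functions_intros(1,2))
    qed simp_all
    from pullback[OF open_X this]
    have "(\<lambda>x. x i) \<circ> \<phi> \<in> functions_on ?S {x \<in> topspace (top_of ?S). \<phi> x \<in> X}" .
    moreover have "{x \<in> topspace (top_of ?S). \<phi> x \<in> X} = ?\<pi> ` carrier G"
      unfolding top_S using image by blast
    moreover have "{x \<in> carrier G. ?\<pi> x \<in> ?\<pi> ` carrier G} = carrier G"
      by blast
    ultimately have "f \<in> functions_on (affine_function_space n (carrier G)) (carrier G)"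
      by (simp only: functions_on_S top_A comp_def f_def)
    then obtain p where p: "p \<in> poly_functions" "\<And>x. x \<in> carrier G \<Longrightarrow> f x = p x"
      using functions_on_affine_function_space[OF closed] by blast
    have "restrict f (carrier G) = restrict p (carrier G)"
      using p(2) by auto
    then have "restrict f (carrier G) \<in> \<O>"
      using p(1) by (simp add: regular_functions_def)
    then have "restrict f (carrier G) \<in> right_invariants H"
      using subgroup.mem_carrier[OF sub]
      by (simp add: right_invariants_def f_def left_coset_mult_right[OF sub])
    then obtain c where "restrict f (carrier G) = (\<lambda>x\<in>carrier G. c)"
      using trivial by blast
    from fun_cong[OF this, of g] fun_cong[OF this, of \<one>] show ?thesis
      using g by (simp add: f_def)
  qed
  have "g \<in> H" if g: "g \<in> carrier G" for g
  proof -
    have "\<phi> (?\<pi> g) = \<phi> (?\<pi> \<one>)"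
      using coordinate[OF g] by (rule ext)
    then have "?\<pi> g = ?\<pi> \<one>"
      using inj_onD[OF inj] g one_closed by blast
    also have "\<dots> = H"
      using subgroup.subset[OF sub] by (rule lcos_mult_one)
    finally have "g <# H = H" .
    moreover have "g \<otimes> \<one> \<in> g <# H"
      unfolding l_coset_def using subgroup.one_closed[OF sub] by blast
    ultimately show ?thesis
      using g by simp
  qed
  then show ?thesis
    using subgroup.subset[OF sub] by blast
qed

section \<open>The center as an algebra\<close>

lemma algebra_center_simps:
  "a \<otimes>\<^bsub>algebra_center B\<^esub> b = a \<otimes>\<^bsub>B\<^esub> b"
  "a \<oplus>\<^bsub>algebra_center (twisted_algebra \<A> J)\<^esub> b = (\<lambda>x\<in>carrier G. a x + b x)"
  "\<one>\<^bsub>algebra_center (twisted_algebra \<A> J)\<^esub> = (\<lambda>x\<in>carrier G. 1)"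
  "c \<odot>\<^bsub>algebra_center (twisted_algebra \<A> J)\<^esub> a = (\<lambda>x\<in>carrier G. c * a x)"
  by (simp_all add: algebra_center_def) (simp_all add: twisted_algebra_def)

lemma quotient_functions_simps:
  "carrier (quotient_functions G H) = right_invariants H"
  "a \<otimes>\<^bsub>quotient_functions G H\<^esub> b = (\<lambda>x\<in>carrier G. a x * b x)"
  "a \<oplus>\<^bsub>quotient_functions G H\<^esub> b = (\<lambda>x\<in>carrier G. a x + b x)"
  "\<one>\<^bsub>quotient_functions G H\<^esub> = (\<lambda>x\<in>carrier G. 1)"
  "c \<odot>\<^bsub>quotient_functions G H\<^esub> a = (\<lambda>x\<in>carrier G. c * a x)"
  by (simp_all add: quotient_functions_def function_algebra_def right_invariants_def)

text \<open>Here J itself plays the role of the minimal cocycle K, with G as the closed subgroup.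
  Right translations are transitive on G, so the invariants are the constants.\<close>

lemma center_trivial_if_minimal:
  assumes J: "hopf_2cocycle \<A> J" and minimal: "minimal_form \<A> J"
  shows "trivial_algebra (algebra_center (twisted_algebra \<A> J))"
proof -
  have "closed_subgroup n G (carrier G)"
    using closed subgroup_self by (simp add: closed_subgroup_def)
  moreover have "G\<lparr>carrier := carrier G\<rparr> = G"
    by simp
  moreover have "bilinear_form \<A> J"
    using J by (simp add: hopf_2cocycle_def)
  ultimately have center: "carrier (algebra_center (twisted_algebra \<A> J)) = right_invariants (carrier G)"
    using carrier_center_twisted[of "carrier G" J J] J minimal by (simp add: restrict_regular_function)
  have "\<exists>c. f = (\<lambda>x\<in>carrier G. c)" if f: "f \<in> right_invariants (carrier G)" for f
  proof
    have "f x = f \<one>" if x: "x \<in> carrier G" for x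
    proof -
      have "f (\<one> \<otimes> x) = f \<one>"
        using f x one_closed unfolding right_invariants_def by blast
      then show ?thesis
        using x by simp
    qed
    then have "restrict f (carrier G) = (\<lambda>x\<in>carrier G. f \<one>)"
      by (rule restrict_ext)
    moreover have "restrict f (carrier G) = f"
      using f restrict_regular_function by (simp add: right_invariants_def)
    ultimately show "f = (\<lambda>x\<in>carrier G. f \<one>)"
      by simp
  qed
  moreover have "(\<lambda>x\<in>carrier G. c) \<in> right_invariants (carrier G)" for c
    by (simp add: right_invariants_def regular_functions_intros(1))
  ultimately have "right_invariants (carrier G) = {(\<lambda>x\<in>carrier G. c) |c. True}"
    by blast
  then show ?thesis
    by (simp add: trivial_algebra_def center algebra_center_simps cong: restrict_cong)
qed

text \<open>\<open>left_act \<chi>\<close> is an algebra isomorphism onto the algebra twisted by the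
  pullback of K, so it maps center onto center. On the center of the target the twisted product is
  the pointwise one, which makes the map multiplicative into O(G/H).\<close>

lemma center_gauge_isomorphism:
  assumes \<chi>: "linear_form \<A> \<chi>" "convolution_inverse \<A> \<chi> \<chi>'" "\<chi> (\<lambda>x\<in>carrier G. 1) = 1"
    and J: "bilinear_form \<A> J"
    and H: "closed_subgroup n G H"
    and K: "hopf_2cocycle (regular_bialgebra (G\<lparr>carrier := H\<rparr>)) K"
      "minimal_form (regular_bialgebra (G\<lparr>carrier := H\<rparr>)) K"
    and gauge: "\<And>a b. a \<in> \<O> \<Longrightarrow> b \<in> \<O> \<Longrightarrow> K (restrict a H) (restrict b H) =
      convolution2 \<A> (convolution2 \<A> (\<lambda>x y. \<chi> (x \<otimes>\<^bsub>\<A>\<^esub> y)) J) (\<lambda>x y. \<chi>' x * \<chi>' y) a b"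
  defines "Z \<equiv> algebra_center (twisted_algebra \<A> J)"
  shows "left_act \<chi> \<in> ring_iso Z (quotient_functions G H)"
    and "\<And>c a. a \<in> carrier Z \<Longrightarrow> left_act \<chi> (c \<odot>\<^bsub>Z\<^esub> a) = c \<odot>\<^bsub>quotient_functions G H\<^esub> left_act \<chi> a"
proof -
  define J' where "J' = (\<lambda>a b. K (restrict a H) (restrict b H))"
  let ?B = "twisted_algebra \<A> J" and ?B' = "twisted_algebra \<A> J'"
  note \<chi>' = convolution_inverse_linear[OF \<chi>(2)]
  have J'_gauge: "J' a b = convolution2 \<A> (convolution2 \<A> (\<lambda>x y. \<chi> (x \<otimes>\<^bsub>\<A>\<^esub> y)) J) (\<lambda>x y. \<chi>' x * \<chi>' y) a b"
    if "a \<in> \<O>" "b \<in> \<O>" for a b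
    unfolding J'_def by (rule gauge[OF that])
  \<comment> \<open>Bilinearity of the pullback is read off from the gauge formula, with which it
    agrees on O(G).\<close>
  have J': "bilinear_form \<A> J'"
    by (rule bilinear_form_cong[OF bilinear_form_convolution2[OF bilinear_form_convolution2[OF
            bilinear_form_mult[OF \<chi>(1)] J] bilinear_form_product[OF \<chi>' \<chi>']] J'_gauge])
  have hom: "left_act \<chi> (a \<otimes>\<^bsub>?B\<^esub> b) = left_act \<chi> a \<otimes>\<^bsub>?B'\<^esub> left_act \<chi> b" if "a \<in> \<O>" "b \<in> \<O>" for a b
    by (rule left_act_twisted_mult[OF \<chi>(1,2) J J' J'_gauge that])
  note closed = left_act_closed[OF \<chi>(1)] left_act_closed[OF \<chi>']
  note inverse = convolution_inverse_act(1,2)[OF \<chi>(1,2)]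
  have J'_eq: "J' a b = K (restrict a H) (restrict b H)" for a b
    by (simp add: J'_def)
  have center': "carrier (algebra_center ?B') = right_invariants H"
    by (rule carrier_center_twisted[OF H K(1) J' J'_eq K(2)])
  have to: "left_act \<chi> z \<in> right_invariants H" if z: "z \<in> carrier Z" for z
  proof -
    have z': "z \<in> \<O>" "\<And>b. b \<in> \<O> \<Longrightarrow> z \<otimes>\<^bsub>?B\<^esub> b = b \<otimes>\<^bsub>?B\<^esub> z"
      using z by (simp_all add: Z_def carrier_center)
    have "left_act \<chi> z \<otimes>\<^bsub>?B'\<^esub> b = b \<otimes>\<^bsub>?B'\<^esub> left_act \<chi> z" if b: "b \<in> \<O>" for b
      using hom[OF z'(1) closed(2)[OF b]] hom[OF closed(2)[OF b] z'(1)] z'(2)[OF closed(2)[OF b]]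
      by (simp add: inverse(1)[OF b])
    then show ?thesis
      using closed(1)[OF z'(1)] by (simp add: center'[symmetric] carrier_center)
  qed
  have "left_act \<chi>' w \<in> carrier Z" if w: "w \<in> right_invariants H" for w
  proof -
    have w': "w \<in> \<O>" "\<And>b. b \<in> \<O> \<Longrightarrow> w \<otimes>\<^bsub>?B'\<^esub> b = b \<otimes>\<^bsub>?B'\<^esub> w"
      using w by (simp_all add: center'[symmetric] carrier_center)
    have "left_act \<chi>' w \<otimes>\<^bsub>?B\<^esub> b = b \<otimes>\<^bsub>?B\<^esub> left_act \<chi>' w" if b: "b \<in> \<O>" for b
    proof -
      \<comment> \<open>Commutation is compared after applying \<open>left_act \<chi>\<close>, which
        is injective and multiplicative.\<close>
      have "left_act \<chi> (left_act \<chi>' w \<otimes>\<^bsub>?B\<^esub> b) = left_act \<chi> (b \<otimes>\<^bsub>?B\<^esub> left_act \<chi>' w)"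
        using w'(2)[OF closed(1)[OF b]]
        by (simp add: hom[OF closed(2)[OF w'(1)] b] hom[OF b closed(2)[OF w'(1)]] inverse(1)[OF w'(1)])
      then show ?thesis
        using inverse(2)[OF twisted_mult_closed[OF closed(2)[OF w'(1)] b]]
          inverse(2)[OF twisted_mult_closed[OF b closed(2)[OF w'(1)]]] by metis
    qed
    then show ?thesis
      using closed(2)[OF w'(1)] by (simp add: Z_def carrier_center)
  qed
  moreover have Z_regular: "z \<in> \<O>" if "z \<in> carrier Z" for z
    using that by (simp add: Z_def carrier_center)
  moreover have inv_regular: "w \<in> \<O>" if "w \<in> right_invariants H" for w
    using that by (simp add: right_invariants_def)
  ultimately have bij: "bij_betw (left_act \<chi>) (carrier Z) (right_invariants H)"
    by (intro bij_betw_byWitness[where f' = "left_act \<chi>'"]) (auto simp: inverse to)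
  have "left_act \<chi> (\<lambda>x\<in>carrier G. 1) = (\<lambda>x\<in>carrier G. 1)"
    using \<chi>(3) by (auto simp: left_act_def left_translate_def cong: restrict_cong)
  then have "left_act \<chi> \<in> ring_hom Z (quotient_functions G H)"
    using to Z_regular left_act_add[OF \<chi>(1)] hom twisted_mult_right_invariants(1)[OF H K(1) J' J'_eq] inv_regular
    by (intro ring_hom_memI)
      (simp_all add: quotient_functions_simps, simp_all add: Z_def algebra_center_simps)
  then show "left_act \<chi> \<in> ring_iso Z (quotient_functions G H)"
    using bij by (simp add: ring_iso_def quotient_functions_simps)
  show "left_act \<chi> (c \<odot>\<^bsub>Z\<^esub> a) = c \<odot>\<^bsub>quotient_functions G H\<^esub> left_act \<chi> a" if "a \<in> carrier Z" for c a
    using left_act_scale[OF \<chi>(1) Z_regular[OF that]]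
    by (simp add: quotient_functions_simps Z_def algebra_center_simps)
qed

end

theorem theorem3p5:
  fixes n :: nat and G :: "point monoid" and J :: "(point \<Rightarrow> complex) form" and H :: "point set"
  assumes "affine_algebraic_group n G"
    and "hopf_2cocycle (regular_bialgebra G) J"
    and "is_support n G J H"
  shows "let Z = algebra_center (twisted_algebra (regular_bialgebra G) J) in
    algebra_isomorphic Z (quotient_functions G H) \<and>
    (minimal_form (regular_bialgebra G) J \<longrightarrow> trivial_algebra Z) \<and>
    (is_affine (quotient_variety n G H) \<longrightarrow> trivial_algebra Z \<longrightarrow>
      minimal_form (regular_bialgebra G) J)"
proof -
  interpret affine_algebraic_group n G
    by (fact assms(1))
  let ?Z = "algebra_center (twisted_algebra (regular_bialgebra G) J)"
  have H: "closed_subgroup n G H"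
    using assms(3) by (simp add: is_support_def)
  obtain K where K: "hopf_2cocycle (regular_bialgebra (G\<lparr>carrier := H\<rparr>)) K"
      "minimal_form (regular_bialgebra (G\<lparr>carrier := H\<rparr>)) K"
    and "gauge_equivalent (regular_bialgebra G) J (\<lambda>a b. K (restrict a H) (restrict b H))"
    using assms(3) unfolding is_support_def by blast
  then obtain \<chi> \<chi>' where \<chi>: "linear_form \<A> \<chi>" "convolution_inverse \<A> \<chi> \<chi>'" "\<chi> (\<lambda>x\<in>carrier G. 1) = 1"
    and gauge: "\<And>a b. a \<in> \<O> \<Longrightarrow> b \<in> \<O> \<Longrightarrow> K (restrict a H) (restrict b H) =
      convolution2 \<A> (convolution2 \<A> (\<lambda>x y. \<chi> (x \<otimes>\<^bsub>\<A>\<^esub> y)) J) (\<lambda>x y. \<chi>' x * \<chi>' y) a b"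
    unfolding gauge_equivalent_def regular_bialgebra_simps(1,5) by blast
  have J: "bilinear_form \<A> J"
    using assms(2) by (simp add: hopf_2cocycle_def)
  have iso: "left_act \<chi> \<in> ring_iso ?Z (quotient_functions G H)"
    by (rule center_gauge_isomorphism(1)[OF \<chi> J H K]) (rule gauge)
  have iso_smult: "left_act \<chi> (c \<odot>\<^bsub>?Z\<^esub> a) = c \<odot>\<^bsub>quotient_functions G H\<^esub> left_act \<chi> a"
    if "a \<in> carrier ?Z" for c a
    by (rule center_gauge_isomorphism(2)[OF \<chi> J H K _ that]) (rule gauge)
  have minimal: "minimal_form \<A> J" if affine: "is_affine (quotient_variety n G H)" and trivial: "trivial_algebra ?Z"
  proof -
    \<comment> \<open>Triviality travels along the isomorphism: multiples of the unit of the center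
      go to multiples of the unit of O(G/H), which are the constants.\<close>
    have "\<exists>c. f = (\<lambda>x\<in>carrier G. c)" if f: "f \<in> right_invariants H" for f
    proof -
      have one: "left_act \<chi> \<one>\<^bsub>?Z\<^esub> = \<one>\<^bsub>quotient_functions G H\<^esub>"
        using iso unfolding ring_iso_def ring_hom_def by blast
      have image: "left_act \<chi> ` carrier ?Z = right_invariants H"
        using iso unfolding ring_iso_def bij_betw_def quotient_functions_simps(1) by blast
      obtain z where z: "z \<in> carrier ?Z" "f = left_act \<chi> z"
        using f image by blast
      have Z: "carrier ?Z = {c \<odot>\<^bsub>?Z\<^esub> \<one>\<^bsub>?Z\<^esub> |c. True}"
        using trivial by (simp only: trivial_algebra_def)
      then obtain c where c: "z = c \<odot>\<^bsub>?Z\<^esub> \<one>\<^bsub>?Z\<^esub>"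
        using z(1) by blast
      \<comment> \<open>A trivial center contains its unit as the multiple with coefficient 1;
        \<open>iso_smult\<close> asks for this membership.\<close>
      have "1 \<odot>\<^bsub>?Z\<^esub> \<one>\<^bsub>?Z\<^esub> \<in> carrier ?Z"
        by (subst Z) (rule CollectI, intro exI[of _ 1] conjI refl TrueI)
      then have "\<one>\<^bsub>?Z\<^esub> \<in> carrier ?Z"
        by (simp add: algebra_center_simps cong: restrict_cong)
      then have "f = c \<odot>\<^bsub>quotient_functions G H\<^esub> \<one>\<^bsub>quotient_functions G H\<^esub>"
        using iso_smult[of "\<one>\<^bsub>?Z\<^esub>" c] by (simp only: z(2) c one)
      then show ?thesis
        by (intro exI[of _ c]) (simp add: quotient_functions_simps cong: restrict_cong)
    qed
    from affine_quotient_variety_trivial[OF H affine this] have H_eq: "H = carrier G" .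
    \<comment> \<open>With H = G the minimal K is a cocycle on G itself, and the gauge formula
      relates it directly to J.\<close>
    have "G\<lparr>carrier := H\<rparr> = G"
      by (simp add: H_eq)
    then have K': "hopf_2cocycle \<A> K" "minimal_form \<A> K"
      using K by simp_all
    have K_gauge: "K a b = convolution2 \<A> (convolution2 \<A> (\<lambda>x y. \<chi> (x \<otimes>\<^bsub>\<A>\<^esub> y)) J) (\<lambda>x y. \<chi>' x * \<chi>' y) a b"
      if "a \<in> \<O>" "b \<in> \<O>" for a b
      using gauge[OF that] that by (simp only: H_eq restrict_regular_function)
    show ?thesis
      by (rule minimal_form_gauge[OF \<chi>(1,2) assms(2) K'(1) _ K'(2)]) (rule K_gauge)
  qed
  have "algebra_isomorphic ?Z (quotient_functions G H)"
    unfolding algebra_isomorphic_def by (rule bexI[OF _ iso]) (intro allI ballI iso_smult)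
  then show ?thesis
    unfolding Let_def using center_trivial_if_minimal[OF assms(2)] minimal by (intro conjI impI)
qed

end
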